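(* Let $0<\alpha<n$, let $1<p_0<n/\alpha$ and $q_0$ be defined by the equations $1/q_0=1/p_0-\alpha/n$ and $q_0/p_0'=1-\alpha/n$, and let $w\in A_{p_0,q_0}$. Then $$\|w\,I_\alpha f\|_{L^{q_0}(\mathbb{R}^n)}\le c\,[w]_{A_{p_0,q_0}}\,\|wf\|_{L^{p_0}(\mathbb{R}^n)}$$ for all $f$ with $wf\in L^{p_0}(\mathbb{R}^n)$, where the constant $c$ is independent of $w$ and $f$.
   Context: For $0<\alpha<n$, the fractional integral operator (Riesz potential) is $I_\alpha f(x)=\int_{\mathbb{R}^n}\frac{f(y)}{|x-y|^{n-\alpha}}\,dy$. A weight is a non-negative locally integrable function on $\mathbb{R}^n$. For $1<p<\infty$, $p'$ is defined by $1/p+1/p'=1$. For $1<p\le q<\infty$, a weight $w$ belongs to $A_{p,q}$ if $$[w]_{A_{p,q}}=\sup_Q\left(\frac1{|Q|}\int_Q w^q\,dx\right)\left(\frac1{|Q|}\int_Q w^{-p'}\,dx\right)^{q/p'}<\infty,$$ the supremum being over all cubes $Q\subset\mathbb{R}^n$ with sides parallel to the axes. *)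

theory Defs
  imports "HOL-Analysis.Analysis"
begin

(* Real powers on [0,\<infinity>]. Note that 0 powr a = 0 on the reals even for a < 0, whereas here
   0 to a negative power is \<infinity>; this matters for w powr (-p') at the zeros of a weight w. *)
definition ennpowr :: "ennreal \<Rightarrow> real \<Rightarrow> ennreal" where
  "ennpowr t a =
     (if a = 0 then 1
      else if t = 0 then (if a > 0 then 0 else \<infinity>)
      else if t = \<infinity> then (if a > 0 then \<infinity> else 0)
      else ennreal (enn2real t powr a))"

definition Lp_norm :: "'a measure \<Rightarrow> real \<Rightarrow> ('a \<Rightarrow> 'b::real_normed_vector) \<Rightarrow> ennreal" where
  "Lp_norm M p f = ennpowr (\<integral>\<^sup>+ x. ennreal (norm (f x) powr p) \<partial>M) (1 / p)"

definition Lp_space :: "'a measure \<Rightarrow> real \<Rightarrow> ('a \<Rightarrow> 'b::real_normed_vector) set" where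
  "Lp_space M p = {f \<in> borel_measurable M. Lp_norm M p f < \<infinity>}"

definition conj_exponent :: "real \<Rightarrow> real" where
  "conj_exponent p = p / (p - 1)"

lemma conj_exponent_eq:
  assumes "p > 1"
  shows "1 / p + 1 / conj_exponent p = 1"
  using assms by (simp add: conj_exponent_def field_simps)

definition riesz_kernel :: "real \<Rightarrow> real ^ 'n \<Rightarrow> real" where
  "riesz_kernel \<alpha> z = 1 / norm z powr (real CARD('n) - \<alpha>)"

(* As a Bochner integral this is 0 wherever the integrand is not absolutely integrable, so
   convergence has to be stated separately. *)
definition riesz_potential :: "real \<Rightarrow> (real ^ 'n \<Rightarrow> complex) \<Rightarrow> real ^ 'n \<Rightarrow> complex" where
  "riesz_potential \<alpha> f x = (LINT y|lebesgue. riesz_kernel \<alpha> (x - y) *\<^sub>R f y)"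

definition riesz_converges :: "real \<Rightarrow> (real ^ 'n \<Rightarrow> complex) \<Rightarrow> real ^ 'n \<Rightarrow> bool" where
  "riesz_converges \<alpha> f x \<longleftrightarrow> integrable lebesgue (\<lambda>y. riesz_kernel \<alpha> (x - y) *\<^sub>R f y)"

definition weight :: "(real ^ 'n \<Rightarrow> real) \<Rightarrow> bool" where
  "weight w \<longleftrightarrow> (\<forall>x. w x \<ge> 0) \<and> (\<forall>K. compact K \<longrightarrow> set_integrable lebesgue K w)"

definition cubes :: "(real ^ 'n) set set" where
  "cubes = {cbox a (a + (\<chi> i. l)) | a l. l > 0}"

definition avg :: "(real ^ 'n) set \<Rightarrow> (real ^ 'n \<Rightarrow> ennreal) \<Rightarrow> ennreal" where
  "avg Q g = (\<integral>\<^sup>+ x\<in>Q. g x \<partial>lebesgue) / emeasure lebesgue Q"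

(* The product follows the measure-theoretic convention 0 * \<infinity> = 0. *)
definition Apq_const :: "real \<Rightarrow> real \<Rightarrow> (real ^ 'n \<Rightarrow> real) \<Rightarrow> ennreal" where
  "Apq_const p q w =
     (SUP Q\<in>cubes. avg Q (\<lambda>x. ennpowr (ennreal (w x)) q) *
        ennpowr (avg Q (\<lambda>x. ennpowr (ennreal (w x)) (- conj_exponent p))) (q / conj_exponent p))"

definition Apq :: "real \<Rightarrow> real \<Rightarrow> (real ^ 'n \<Rightarrow> real) set" where
  "Apq p q = {w. weight w \<and> Apq_const p q w < \<infinity>}"

end

theory Submission
  imports Defs
begin

text \<open>
  Write \<open>n\<close> for the dimension, \<open>b = 1 - \<alpha> / n\<close>, \<open>u = w powr q\<close> and \<open>\<sigma> = w powr - p'\<close>. Substituting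
  \<open>f * \<sigma>\<close> for the function to which the potential is applied, the claim says that
  \<open>f \<mapsto> I\<^sub>\<alpha> (f * \<sigma>)\<close> maps \<open>L\<^sup>p(\<sigma>)\<close> to \<open>L\<^sup>q(u)\<close> with norm at most a multiple of the weight constant. By
  duality (\<open>nn_integral_power_le_by_duality\<close>) it suffices to bound the integral of
  \<open>I\<^sub>\<alpha> (f * \<sigma>) * g * u\<close> by the norms of \<open>f\<close> in \<open>L\<^sup>p(\<sigma>)\<close> and of \<open>g\<close> in \<open>L\<^bsup>q'\<^esup>(u)\<close>, for non-negative functions.

  The kernel, truncated at a large distance, is up to a constant dominated by a sum of
  \<open>|Q| powr - b\<close> over the cells \<open>Q\<close> of finitely many translated dyadic
  grids that contain both points (\<open>truncated_riesz_le_grid_sum\<close>). On one grid this leaves the sum over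
  \<open>Q\<close> of \<open>|Q| powr - b * \<sigma>(Q) * u(Q)\<close> times the \<open>\<sigma>\<close>-average of \<open>f\<close> and the \<open>u\<close>-average of \<open>g\<close>. The
  weight condition, in which \<open>\<sigma>\<close> carries the exponent \<open>q / p' = b\<close>, replaces the first factor by
  \<open>|Q| * \<sigma>(Q) powr (1 - b)\<close> at the cost of exactly one power of the weight constant.

  This sum has too many terms, and it is thinned out without stopping cubes
  (\<open>bilinear_estimate\<close>). For a fixed point, let \<open>s\<close> be the running maximum of the averages of \<open>f * \<sigma>\<close> over
  the cells that contain the point, from large to small cells, with increments \<open>D\<close> and limit \<open>M\<close>. Abel
  summation against the geometric factors replaces averages by increments
  (\<open>suminf_le_increments\<close>), which vanish unless a new maximum is reached. In that case \<open>M\<close> is at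
  most twice the present average on half of the cell (\<open>maximal_le_twice_on_half\<close>). So the factor \<open>|Q|\<close> may be
  traded, up to the constant \<open>4\<close>, for an integral of \<open>s / M\<close> over \<open>Q\<close>; and since the weights \<open>D / M\<close> sum
  to at most one, the sum over the cells becomes a supremum.

  What remains is the integral of a fractional maximal function of \<open>f\<close> with respect to \<open>\<sigma>\<close> times a maximal
  function of \<open>g\<close> with respect to \<open>u\<close>, both along a grid. At the critical exponents
  \<open>\<sigma> powr (1 / q) * u powr (1 / q') = 1\<close>, so Hoelder's inequality separates the two, and maximal functions
  along a grid are bounded for every measure, with constants that depend on the exponent only
  (\<open>maximal_strong_type\<close>, \<open>fractional_cavg_le_maximal\<close>). No further dependence on the weight arises.
\<close>

section \<open>Real powers on the extended half-line\<close>

lemma ennpowr_ennreal: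
  assumes "0 \<le> x" "0 < a"
  shows "ennpowr (ennreal x) a = ennreal (x powr a)"
  using assms by (auto simp: ennpowr_def)

lemma ennpowr_ennreal_pos:
  assumes "0 < x"
  shows "ennpowr (ennreal x) a = ennreal (x powr a)"
  using assms by (auto simp: ennpowr_def)

lemma ennpowr_zero [simp]: "0 < a \<Longrightarrow> ennpowr 0 a = 0"
  by (simp add: ennpowr_def)

lemma ennpowr_top [simp]: "0 < a \<Longrightarrow> ennpowr top a = top"
  by (simp add: ennpowr_def)

lemma ennpowr_one_left [simp]: "ennpowr 1 a = 1"
  by (simp add: ennpowr_def)

lemma ennpowr_one [simp]: "ennpowr t 1 = t"
  by (cases t) (auto simp: ennpowr_def)

lemma ennpowr_eq_0_iff: "0 < a \<Longrightarrow> ennpowr t a = 0 \<longleftrightarrow> t = 0"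
  by (cases t) (auto simp: ennpowr_ennreal ennreal_eq_0_iff)

lemma ennpowr_eq_top_iff: "0 < a \<Longrightarrow> ennpowr t a = top \<longleftrightarrow> t = top"
  by (cases t) (auto simp: ennpowr_ennreal)

lemma ennpowr_less_top_iff: "0 < a \<Longrightarrow> ennpowr t a < top \<longleftrightarrow> t < top"
  using ennpowr_eq_top_iff[of a t] by (metis top.not_eq_extremum)

lemma ennpowr_mono: "0 < a \<Longrightarrow> s \<le> t \<Longrightarrow> ennpowr s a \<le> ennpowr t a"
  by (cases s; cases t) (auto simp: ennpowr_ennreal powr_mono2 ennreal_le_iff top_unique)

lemma ennpowr_mult: "0 < a \<Longrightarrow> ennpowr (s * t) a = ennpowr s a * ennpowr t a"
  by (cases s; cases t)
     (auto simp: ennpowr_ennreal powr_mult ennreal_mult_top ennreal_top_mult ennpowr_eq_0_iff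
        simp flip: ennreal_mult)

lemma ennpowr_ennpowr: "0 < a \<Longrightarrow> 0 < b \<Longrightarrow> ennpowr (ennpowr t a) b = ennpowr t (a * b)"
  by (cases t) (auto simp: ennpowr_ennreal powr_powr)

lemma ennpowr_add: "0 < a \<Longrightarrow> 0 < b \<Longrightarrow> ennpowr t (a + b) = ennpowr t a * ennpowr t b"
  by (cases t) (auto simp: ennpowr_ennreal powr_add simp flip: ennreal_mult)

text \<open>Positive powers are order isomorphisms of \<open>[0,\<infinity>]\<close>; this turns bounds on
  integrals of powers into bounds on norms.\<close>

lemma ennpowr_le_iff_root: "0 < a \<Longrightarrow> ennpowr s a \<le> t \<longleftrightarrow> s \<le> ennpowr t (1 / a)"
  using ennpowr_mono[of a s "ennpowr t (1 / a)"] ennpowr_mono[of "1 / a" "ennpowr s a" t]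
  by (auto simp: ennpowr_ennpowr)

lemma borel_measurable_ennpowr [measurable]:
  assumes [measurable]: "f \<in> borel_measurable M"
  shows "(\<lambda>x. ennpowr (f x) a) \<in> borel_measurable M"
  unfolding ennpowr_def by measurable

section \<open>Hoelder's inequality and duality\<close>

lemma ennreal_Youngs_inequality:
  fixes s t :: ennreal
  assumes "1 < p" "1 < q" "1 / p + 1 / q = 1"
  shows "s * t \<le> ennreal (1 / p) * ennpowr s p + ennreal (1 / q) * ennpowr t q"
proof (cases "s = top \<or> t = top")
  case True
  with assms show ?thesis
    by (auto simp: ennreal_mult_eq_top_iff)
next
  case False
  then obtain a b where ab: "s = ennreal a" "0 \<le> a" "t = ennreal b" "0 \<le> b"
    by (metis ennreal_cases)
  have "a * b \<le> a powr p / p + b powr q / q"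
    using Youngs_inequality[of p q a b] assms ab by simp
  moreover have "0 \<le> a powr p / p" "0 \<le> b powr q / q" using assms by auto
  ultimately show ?thesis
    using assms ab
    by (simp add: ennpowr_ennreal flip: ennreal_mult ennreal_plus)
qed

text \<open>For integrals that are neither \<open>0\<close> nor \<open>\<infinity>\<close>, Young's inequality is integrated after both
  functions are scaled to norm one.\<close>

theorem nn_integral_Hoelder:
  assumes pq: "1 < p" "1 < q" "1 / p + 1 / q = 1"
    and f [measurable]: "f \<in> borel_measurable M" and g [measurable]: "g \<in> borel_measurable M"
  shows "(\<integral>\<^sup>+x. f x * g x \<partial>M)
           \<le> ennpowr (\<integral>\<^sup>+x. ennpowr (f x) p \<partial>M) (1 / p) * ennpowr (\<integral>\<^sup>+x. ennpowr (g x) q \<partial>M) (1 / q)"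
proof -
  define A where "A = (\<integral>\<^sup>+x. ennpowr (f x) p \<partial>M)"
  define B where "B = (\<integral>\<^sup>+x. ennpowr (g x) q \<partial>M)"
  have p0: "0 < p" "0 < q" "0 < 1 / p" "0 < 1 / q" using pq by auto
  consider "A = 0 \<or> B = 0" | "A \<noteq> 0" "B \<noteq> 0" "A = top \<or> B = top"
    | "A \<noteq> 0" "B \<noteq> 0" "A \<noteq> top" "B \<noteq> top" by blast
  then show ?thesis
  proof cases
    case 1
    have "AE x in M. f x * g x = 0"
      using 1
    proof
      assume "A = 0"
      then have "AE x in M. ennpowr (f x) p = 0"
        unfolding A_def by (subst (asm) nn_integral_0_iff_AE) auto
      then show ?thesis by eventually_elim (simp add: ennpowr_eq_0_iff p0)
    next
      assume "B = 0"
      then have "AE x in M. ennpowr (g x) q = 0"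
        unfolding B_def by (subst (asm) nn_integral_0_iff_AE) auto
      then show ?thesis by eventually_elim (simp add: ennpowr_eq_0_iff p0)
    qed
    then have "(\<integral>\<^sup>+x. f x * g x \<partial>M) = 0"
      by (subst nn_integral_0_iff_AE) auto
    then show ?thesis by simp
  next
    case 2
    then have "ennpowr A (1 / p) * ennpowr B (1 / q) = top"
      using p0 by (auto simp: ennreal_mult_eq_top_iff ennpowr_eq_0_iff)
    then show ?thesis by (simp add: A_def B_def)
  next
    case 3
    then obtain a b where ab: "A = ennreal a" "0 < a" "B = ennreal b" "0 < b"
      by (metis ennreal_cases ennreal_0 less_eq_real_def)
    define c where "c = a powr (1 / p)"
    define d where "d = b powr (1 / q)"
    have cd: "0 < c" "0 < d" "c powr p = a" "d powr q = b"
      using ab p0 by (auto simp: c_def d_def powr_powr)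
    have pt: "f x * g x \<le> ennreal (c * d) * (ennreal (1 / (p * a)) * ennpowr (f x) p
                + ennreal (1 / (q * b)) * ennpowr (g x) q)" for x
    proof -
      have "f x * g x = ennreal (c * d) * ((ennreal (1 / c) * f x) * (ennreal (1 / d) * g x))"
      proof -
        have "ennreal (c * d) * ((ennreal (1 / c) * f x) * (ennreal (1 / d) * g x))
            = (ennreal (c * d) * ennreal (1 / c) * ennreal (1 / d)) * (f x * g x)"
          by (simp only: mult_ac)
        also have "ennreal (c * d) * ennreal (1 / c) * ennreal (1 / d) = 1"
          using cd by (simp flip: ennreal_mult)
        finally show ?thesis by simp
      qed
      also have "\<dots> \<le> ennreal (c * d) *
          (ennreal (1 / p) * ennpowr (ennreal (1 / c) * f x) p
            + ennreal (1 / q) * ennpowr (ennreal (1 / d) * g x) q)"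
        by (intro mult_left_mono ennreal_Youngs_inequality pq) auto
      also have "\<dots> = ennreal (c * d) * (ennreal (1 / (p * a)) * ennpowr (f x) p
                + ennreal (1 / (q * b)) * ennpowr (g x) q)"
        using cd p0 ab
        by (simp add: ennpowr_mult ennpowr_ennreal powr_divide mult.assoc[symmetric] flip: ennreal_mult)
      finally show ?thesis .
    qed
    have "(\<integral>\<^sup>+x. f x * g x \<partial>M) \<le> (\<integral>\<^sup>+x. ennreal (c * d) * (ennreal (1 / (p * a)) * ennpowr (f x) p
                + ennreal (1 / (q * b)) * ennpowr (g x) q) \<partial>M)"
      by (intro nn_integral_mono pt)
    also have "\<dots> = ennreal (c * d) * (ennreal (1 / (p * a)) * A + ennreal (1 / (q * b)) * B)"
      by (simp add: nn_integral_cmult nn_integral_add A_def B_def)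
    also have "\<dots> = ennreal (c * d) * ennreal (1 / p + 1 / q)"
      using ab p0 by (simp flip: ennreal_mult ennreal_plus)
    also have "\<dots> = ennreal (c * d)" using pq by simp
    also have "\<dots> = ennpowr A (1 / p) * ennpowr B (1 / q)"
      using ab p0 cd by (simp add: ennpowr_ennreal ennreal_mult c_def d_def)
    finally show ?thesis by (simp add: A_def B_def)
  qed
qed

text \<open>The test function \<open>h powr (q - 1)\<close> would give the bound at once, were all integrals known to be
  finite. Truncating it in height and to a set of finite measure makes them finite, so that one may
  divide by the norm of the test function; the truncation is then removed by monotone convergence.\<close>

theorem nn_integral_power_le_by_duality:
  fixes M :: "'a measure"
  assumes pq: "1 < q" "1 < q'" "1 / q + 1 / q' = 1"
    and h [measurable]: "h \<in> borel_measurable M"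
    and sf: "sigma_finite_measure M"
    and B: "B < \<infinity>"
    and test: "\<And>g. g \<in> borel_measurable M \<Longrightarrow>
            (\<integral>\<^sup>+x. h x * g x \<partial>M) \<le> B * ennpowr (\<integral>\<^sup>+x. ennpowr (g x) q' \<partial>M) (1 / q')"
  shows "(\<integral>\<^sup>+x. ennpowr (h x) q \<partial>M) \<le> ennpowr B q"
proof -
  interpret sigma_finite_measure M by (rule sf)
  obtain A :: "nat \<Rightarrow> 'a set" where A: "range A \<subseteq> sets M" "(\<Union>k. A k) = space M"
      "\<And>k. emeasure M (A k) \<noteq> \<infinity>" "incseq A"
    using sigma_finite_incseq by blast
  have [measurable]: "A k \<in> sets M" for k using A(1) by auto
  have q': "(q - 1) * q' = q" using pq by (simp add: field_simps)
  define X where "X k x = ennpowr (min (h x) (of_nat k)) q * indicator (A k) x" for k x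
  have Xm [measurable]: "X k \<in> borel_measurable M" for k unfolding X_def by measurable
  have le: "(\<integral>\<^sup>+x. X k x \<partial>M) \<le> ennpowr B q" for k
  proof -
    define I where "I = (\<integral>\<^sup>+x. X k x \<partial>M)"
    define g where "g x = ennpowr (min (h x) (of_nat k)) (q - 1) * indicator (A k) x" for x
    have [measurable]: "g \<in> borel_measurable M" unfolding g_def by measurable
    have gq: "ennpowr (g x) q' = X k x" for x
      using pq q' by (auto simp: g_def X_def ennpowr_mult ennpowr_ennpowr split: split_indicator)
    have hg: "X k x \<le> h x * g x" for x
    proof -
      have "ennpowr (min (h x) (of_nat k)) q
          = ennpowr (min (h x) (of_nat k)) 1 * ennpowr (min (h x) (of_nat k)) (q - 1)"
        using pq by (subst ennpowr_add[symmetric]) auto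
      also have "\<dots> \<le> h x * ennpowr (min (h x) (of_nat k)) (q - 1)"
        by (intro mult_right_mono) auto
      finally show ?thesis unfolding X_def g_def
        by (simp add: mult.assoc[symmetric] mult_right_mono)
    qed
    have "I \<le> (\<integral>\<^sup>+x. ennpowr (of_nat k) q * indicator (A k) x \<partial>M)"
      unfolding I_def X_def using pq by (intro nn_integral_mono mult_right_mono ennpowr_mono) auto
    also have "\<dots> = ennpowr (of_nat k) q * emeasure M (A k)"
      by (simp add: nn_integral_cmult)
    also have "\<dots> < top"
      using A(3)[of k] pq by (auto simp: less_top ennreal_mult_less_top ennpowr_less_top_iff ennreal_of_nat_eq_real_of_nat)
    finally have fin: "I < top" .
    have "I \<le> (\<integral>\<^sup>+x. h x * g x \<partial>M)"
      unfolding I_def by (intro nn_integral_mono hg)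
    also have "\<dots> \<le> B * ennpowr I (1 / q')"
      using test[of g] by (simp add: gq I_def)
    finally have main: "I \<le> B * ennpowr I (1 / q')" .
    have "ennpowr I (1 / q) \<le> B"
    proof (cases "I = 0")
      case True then show ?thesis using pq by simp
    next
      case False
      then obtain i where i: "I = ennreal i" "0 < i"
        using fin by (metis ennreal_cases ennreal_0 less_eq_real_def less_irrefl)
      obtain b where b: "B = ennreal b" "0 \<le> b" using B by (metis ennreal_cases less_irrefl infinity_ennreal_def)
      have "ennreal i \<le> ennreal (b * i powr (1 / q'))"
        using main i b pq by (simp add: ennpowr_ennreal ennreal_mult)
      then have "i \<le> b * i powr (1 / q')" using b by (subst (asm) ennreal_le_iff) auto
      moreover have "i = i powr (1 / q) * i powr (1 / q')"
        using i pq by (simp flip: powr_add)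
      ultimately have "i powr (1 / q) * i powr (1 / q') \<le> b * i powr (1 / q')" by simp
      then have "i powr (1 / q) \<le> b" using i by simp
      then show ?thesis using i b pq by (simp add: ennpowr_ennreal)
    qed
    then have "I \<le> ennpowr B q" using ennpowr_le_iff_root[of "1 / q" I B] pq by simp
    then show ?thesis by (simp add: I_def)
  qed
  have sup: "(SUP k. X k x) = ennpowr (h x) q" if x: "x \<in> space M" for x
  proof -
    obtain k0 where k0: "x \<in> A k0" using x A(2) by auto
    have Ak: "x \<in> A k" if "k0 \<le> k" for k using k0 A(4) that by (auto dest: incseqD)
    show ?thesis
    proof (rule antisym)
      show "(SUP k. X k x) \<le> ennpowr (h x) q"
        using pq by (intro SUP_least) (auto simp: X_def ennpowr_mono split: split_indicator)
      show "ennpowr (h x) q \<le> (SUP k. X k x)"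
      proof (cases "h x = top")
        case False
        then obtain k1 where k1: "h x \<le> of_nat k1"
          by (metis ennreal_Ex_less_of_nat order_less_imp_le top.not_eq_extremum)
        have "h x \<le> of_nat (max k0 k1)" using k1 
          by (meson max.cobounded2 of_nat_mono order_trans)
        then have "ennpowr (h x) q = X (max k0 k1) x"
          using Ak[of "max k0 k1"] by (simp add: X_def min_absorb1)
        then show ?thesis by (metis SUP_upper UNIV_I)
      next
        case True
        have "of_nat k \<le> (SUP k. X k x)" for k
        proof -
          define m where "m = max k (max k0 1)"
          have "(of_nat k :: ennreal) \<le> of_nat m" by (simp add: m_def)
          also have "\<dots> = ennreal (real m powr 1)" by (simp add: ennreal_of_nat_eq_real_of_nat)
          also have "\<dots> \<le> ennreal (real m powr q)"
            using pq by (intro ennreal_leI powr_mono) (auto simp: m_def)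
          also have "\<dots> = X m x"
            using Ak[of m] True pq by (simp add: X_def ennpowr_ennreal m_def
                 flip: ennreal_of_nat_eq_real_of_nat) (simp add: ennreal_of_nat_eq_real_of_nat ennpowr_ennreal)
          also have "\<dots> \<le> (SUP k. X k x)" by (rule SUP_upper[OF UNIV_I])
          finally show ?thesis .
        qed
        then have "(SUP k. X k x) = top"
          by (metis ennreal_Ex_less_of_nat leD top.not_eq_extremum)
        then show ?thesis by (simp only: top_greatest)
      qed
    qed
  qed
  have "(\<integral>\<^sup>+x. ennpowr (h x) q \<partial>M) = (\<integral>\<^sup>+x. (SUP k. X k x) \<partial>M)"
    by (intro nn_integral_cong) (simp add: sup)
  also have "\<dots> = (SUP k. \<integral>\<^sup>+x. X k x \<partial>M)"
  proof (rule nn_integral_monotone_convergence_SUP)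
    show "incseq X"
      unfolding X_def using pq A(4)
      by (intro monoI le_funI mult_mono ennpowr_mono min.mono)
         (auto split: split_indicator dest: incseqD)
  qed auto
  also have "\<dots> \<le> ennpowr B q" by (intro SUP_least le)
  finally show ?thesis .
qed

section \<open>The layer cake formula\<close>

text \<open>The density of \<open>s powr p\<close> on the half-line. The indicator is needed because \<open>s powr a\<close> does not
  vanish for negative \<open>s\<close>.\<close>

definition layer_density :: "real \<Rightarrow> real \<Rightarrow> ennreal" where
  "layer_density p s = ennreal (p * s powr (p - 1)) * indicator {0<..} s"

lemma measurable_layer_density [measurable]: "layer_density p \<in> borel_measurable borel"
  unfolding layer_density_def by measurable

lemma nn_integral_layer_density_ennreal:
  assumes "0 < p" "0 \<le> r"
  shows "(\<integral>\<^sup>+s. layer_density p s * indicator {s. ennreal s < ennreal r} s \<partial>lborel) = ennreal (r powr p)"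
proof -
  have "((\<lambda>s. s powr (p - 1)) has_integral (r powr (p - 1 + 1) / (p - 1 + 1))) {0..r}"
    using assms by (intro has_integral_powr_from_0) auto
  then have "((\<lambda>s. p * s powr (p - 1)) has_integral (p * (r powr p / p))) {0..r}"
    by (intro has_integral_mult_right) simp
  then have "((\<lambda>s. if s \<in> {0..r} then p * s powr (p - 1) else 0) has_integral r powr p) UNIV"
    using assms by (subst has_integral_restrict_UNIV) simp
  then have "(\<integral>\<^sup>+s. ennreal (if s \<in> {0..r} then p * s powr (p - 1) else 0) \<partial>lborel) = ennreal (r powr p)"
    using assms by (intro nn_integral_has_integral_lborel) auto
  moreover have "AE s in lborel. s \<notin> {0, r}"
    by (rule AE_not_in) (auto intro!: finite_imp_null_set_lborel)
  then have "(\<integral>\<^sup>+s. layer_density p s * indicator {s. ennreal s < ennreal r} s \<partial>lborel)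
      = (\<integral>\<^sup>+s. ennreal (if s \<in> {0..r} then p * s powr (p - 1) else 0) \<partial>lborel)"
    by (intro nn_integral_cong_AE, eventually_elim)
       (use assms in \<open>auto simp: layer_density_def ennreal_less_iff split: split_indicator\<close>)
  ultimately show ?thesis by simp
qed

lemma nn_integral_layer_density:
  assumes p: "0 < p"
  shows "(\<integral>\<^sup>+s. layer_density p s * indicator {s. ennreal s < t} s \<partial>lborel) = ennpowr t p"
proof (cases t)
  case (real r)
  then show ?thesis using nn_integral_layer_density_ennreal[OF p, of r] p by (simp add: ennpowr_ennreal)
next
  case top
  have "of_nat k \<le> (\<integral>\<^sup>+s. layer_density p s * indicator {s. ennreal s < t} s \<partial>lborel)" for k
  proof -
    define r where "r = real k powr (1 / p)"
    have "of_nat k = ennreal (r powr p)"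
      using p by (simp add: r_def powr_powr ennreal_of_nat_eq_real_of_nat)
    also have "\<dots> = (\<integral>\<^sup>+s. layer_density p s * indicator {s. ennreal s < ennreal r} s \<partial>lborel)"
      using nn_integral_layer_density_ennreal[OF p, of r] by (simp add: r_def)
    also have "\<dots> \<le> (\<integral>\<^sup>+s. layer_density p s * indicator {s. ennreal s < t} s \<partial>lborel)"
      by (intro nn_integral_mono mult_left_mono) (auto simp: top split: split_indicator)
    finally show ?thesis .
  qed
  then have "(\<integral>\<^sup>+s. layer_density p s * indicator {s. ennreal s < t} s \<partial>lborel) = top"
    by (metis ennreal_Ex_less_of_nat leD top.not_eq_extremum)
  then show ?thesis using p top by simp
qed

text \<open>The maximal inequality uses this twice: without weight for the maximal function, and with weight \<open>h\<close>
  for \<open>2 * h\<close>.\<close>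

lemma nn_integral_layer_cake:
  assumes "sigma_finite_measure \<mu>" and p: "0 < p"
    and [measurable]: "h \<in> borel_measurable \<mu>" "g \<in> borel_measurable \<mu>"
  shows "(\<integral>\<^sup>+x. g x * ennpowr (h x) p \<partial>\<mu>)
    = (\<integral>\<^sup>+s. layer_density p s * (\<integral>\<^sup>+x. g x * indicator {x \<in> space \<mu>. ennreal s < h x} x \<partial>\<mu>) \<partial>lborel)"
proof -
  interpret sigma_finite_measure \<mu> by fact
  interpret P: pair_sigma_finite \<mu> lborel ..
  have [measurable]: "(\<lambda>(x, s). g x * (layer_density p s * indicator {s. ennreal s < h x} s))
      \<in> borel_measurable (\<mu> \<Otimes>\<^sub>M lborel)"
    by measurable
  have [measurable]: "{s. ennreal s < t} \<in> sets borel" for t by measurable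
  have "(\<integral>\<^sup>+x. g x * ennpowr (h x) p \<partial>\<mu>)
      = (\<integral>\<^sup>+x. (\<integral>\<^sup>+s. g x * (layer_density p s * indicator {s. ennreal s < h x} s) \<partial>lborel) \<partial>\<mu>)"
    using p by (subst nn_integral_cmult) (auto simp: nn_integral_layer_density)
  also have "\<dots> = (\<integral>\<^sup>+s. (\<integral>\<^sup>+x. g x * (layer_density p s * indicator {s. ennreal s < h x} s) \<partial>\<mu>) \<partial>lborel)"
    by (rule P.Fubini'[symmetric]) measurable
  also have "\<dots> = (\<integral>\<^sup>+s. layer_density p s * (\<integral>\<^sup>+x. g x * indicator {x \<in> space \<mu>. ennreal s < h x} x \<partial>\<mu>) \<partial>lborel)"
  proof (intro nn_integral_cong)
    fix s :: real
    have "(\<integral>\<^sup>+x. g x * (layer_density p s * indicator {s. ennreal s < h x} s) \<partial>\<mu>)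
      = (\<integral>\<^sup>+x. layer_density p s * (g x * indicator {x \<in> space \<mu>. ennreal s < h x} x) \<partial>\<mu>)"
      by (intro nn_integral_cong) (auto split: split_indicator simp: mult_ac)
    then show "(\<integral>\<^sup>+x. g x * (layer_density p s * indicator {s. ennreal s < h x} s) \<partial>\<mu>)
      = layer_density p s * (\<integral>\<^sup>+x. g x * indicator {x \<in> space \<mu>. ennreal s < h x} x \<partial>\<mu>)"
      by (simp add: nn_integral_cmult)
  qed
  finally show ?thesis .
qed

section \<open>Maximal functions of nested partitions\<close>

text \<open>A dyadic grid enters the weighted theory only through its nesting, so it is modelled as a sequence
  of countable partitions, each finer than the one before. A partition is given by a code for its
  pieces: \<open>c m x\<close> names the piece of generation \<open>m\<close> that contains \<open>x\<close>. There is a coarsest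
  generation, so that every point has a first generation with a given property. The measure is left
  open, since averages are needed for Lebesgue measure and for both weights.\<close>

locale nested_partition =
  fixes c :: "nat \<Rightarrow> 'a::topological_space \<Rightarrow> nat"
  assumes measurable_c [measurable]: "c m \<in> measurable borel (count_space UNIV)"
    and refine: "c (Suc m) x = c (Suc m) y \<Longrightarrow> c m x = c m y"
begin

definition cell :: "nat \<Rightarrow> 'a \<Rightarrow> 'a set" where
  "cell m x = {y. c m y = c m x}"

definition cavg :: "'a measure \<Rightarrow> nat \<Rightarrow> ('a \<Rightarrow> ennreal) \<Rightarrow> 'a \<Rightarrow> ennreal" where
  "cavg \<mu> m h x = (\<integral>\<^sup>+y\<in>cell m x. h y \<partial>\<mu>) / emeasure \<mu> (cell m x)"

definition maximal :: "'a measure \<Rightarrow> ('a \<Rightarrow> ennreal) \<Rightarrow> 'a \<Rightarrow> ennreal" where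
  "maximal \<mu> h x = (SUP m. cavg \<mu> m h x)"

text \<open>Measurability with respect to the partition of generation \<open>m\<close>.\<close>

definition level :: "nat \<Rightarrow> ('a \<Rightarrow> ennreal) \<Rightarrow> bool" where
  "level m h \<longleftrightarrow> (\<forall>x y. c m x = c m y \<longrightarrow> h x = h y)"

text \<open>For these measures, an average times the measure of the cell is the integral over the cell, also on
  cells of measure zero, where the average is \<open>0 / 0 = 0\<close>.\<close>

definition cell_finite :: "'a measure \<Rightarrow> bool" where
  "cell_finite \<mu> \<longleftrightarrow> sets \<mu> = sets borel \<and> (\<forall>m x. emeasure \<mu> (cell m x) < top)"

lemma refine_le:
  assumes "m \<le> k" "c k x = c k y" shows "c m x = c m y"
  using assms by (induction k rule: dec_induct) (auto intro: refine)

lemma self_in_cell [simp]: "x \<in> cell m x"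
  by (simp add: cell_def)

lemma cell_eq: "c m x = c m y \<Longrightarrow> cell m x = cell m y"
  by (simp add: cell_def)

lemma cell_subset:
  assumes "m \<le> k" "y \<in> cell m x" shows "cell k y \<subseteq> cell m x"
proof
  fix z assume "z \<in> cell k y"
  then have "c m z = c m y" using refine_le[OF assms(1), of z y] by (simp add: cell_def)
  then show "z \<in> cell m x" using assms(2) by (simp add: cell_def)
qed

lemma cell_measurable [measurable]: "cell m x \<in> sets borel"
proof -
  have "cell m x = c m -` {c m x} \<inter> space borel" by (auto simp: cell_def)
  then show ?thesis using measurable_sets[OF measurable_c, of "{c m x}" m] by simp
qed

lemma level_cong:
  assumes "level m h" "c m x = c m y" shows "h x = h y"
  using assms(1)[unfolded level_def, rule_format, OF assms(2)] .

lemma levelI: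
  assumes "\<And>x y. c m x = c m y \<Longrightarrow> h x = h y" shows "level m h"
  unfolding level_def by (intro allI impI) (rule assms)

lemma level_mono: "level m h \<Longrightarrow> m \<le> k \<Longrightarrow> level k h"
  by (intro levelI) (rule level_cong, assumption, rule refine_le)

lemma level_cavg: "level m (cavg \<mu> m h)"
proof (rule levelI)
  fix x y assume "c m x = c m y"
  from cell_eq[OF this] show "cavg \<mu> m h x = cavg \<mu> m h y" by (simp only: cavg_def)
qed

lemma level_measurable:
  assumes "level m h" shows "h \<in> borel_measurable borel"
proof -
  define h' where "h' i = h (SOME x. c m x = i)" for i
  have "h x = h' (c m x)" for x
  proof -
    have "c m (SOME y. c m y = c m x) = c m x"
      using someI[of "\<lambda>y. c m y = c m x" x] by blast
    then show ?thesis unfolding h'_def by (intro level_cong[OF assms]) (rule sym)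
  qed
  then have "h = (\<lambda>x. h' (c m x))" by (rule ext)
  moreover have "(\<lambda>x. h' (c m x)) \<in> borel_measurable borel"
    by (rule measurable_compose[OF measurable_c]) simp
  ultimately show ?thesis by (simp only:)
qed

lemma cavg_measurable [measurable]: "cavg \<mu> m h \<in> borel_measurable borel"
  using level_cavg by (rule level_measurable)

lemma maximal_measurable [measurable]: "maximal \<mu> h \<in> borel_measurable borel"
  unfolding maximal_def[abs_def] by measurable

lemma cavg_le_maximal: "cavg \<mu> m h x \<le> maximal \<mu> h x"
  unfolding maximal_def by (rule SUP_upper) simp

lemma cavg_mult_measure:
  assumes "cell_finite \<mu>" and h: "h \<in> borel_measurable borel"
  shows "cavg \<mu> m h x * emeasure \<mu> (cell m x) = (\<integral>\<^sup>+y\<in>cell m x. h y \<partial>\<mu>)"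
proof (cases "emeasure \<mu> (cell m x) = 0")
  case True
  have s: "sets \<mu> = sets borel" using assms by (simp add: cell_finite_def)
  note [measurable_cong] = s
  have "(\<integral>\<^sup>+y\<in>cell m x. h y \<partial>\<mu>) = 0"
    using True s by (intro nn_integral_null_set) (auto simp: null_sets_def)
  then show ?thesis using True by simp
next
  case False
  have "emeasure \<mu> (cell m x) \<noteq> top" using assms by (auto simp: cell_finite_def less_top)
  with False show ?thesis by (simp add: cavg_def ennreal_divide_times less_top)
qed

lemma sigma_finite_of_cell_finite:
  assumes "cell_finite \<mu>" shows "sigma_finite_measure \<mu>"
proof
  have s: "sets \<mu> = sets borel" and f: "\<And>m x. emeasure \<mu> (cell m x) < top"
    using assms by (auto simp: cell_finite_def)
  have sp: "space \<mu> = UNIV" using sets_eq_imp_space_eq[OF s] by simp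
  have "range (cell 0) \<subseteq> (\<lambda>i. {y. c 0 y = i}) ` UNIV" by (auto simp: cell_def)
  then have "countable (range (cell 0))" by (rule countable_subset) simp
  moreover have "range (cell 0) \<subseteq> sets \<mu>" unfolding s by (intro image_subsetI cell_measurable)
  moreover have "\<Union> (range (cell 0)) = space \<mu>" unfolding sp using self_in_cell[of _ 0] by fast
  moreover have "\<forall>a\<in>range (cell 0). emeasure \<mu> a \<noteq> \<infinity>" using f by (simp add: less_top)
  ultimately show "\<exists>A. countable A \<and> A \<subseteq> sets \<mu> \<and> \<Union> A = space \<mu> \<and> (\<forall>a\<in>A. emeasure \<mu> a \<noteq> \<infinity>)"
    by blast
qed

lemma nn_integral_cells:
  assumes s: "sets \<mu> = sets borel" and h: "h \<in> borel_measurable borel"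
  shows "(\<integral>\<^sup>+x. h x \<partial>\<mu>) = (\<Sum>i. \<integral>\<^sup>+x. h x * indicator {y. c m y = i} x \<partial>\<mu>)"
proof -
  note [measurable_cong] = s
  note [measurable] = h
  have "(\<integral>\<^sup>+x. h x \<partial>\<mu>) = (\<integral>\<^sup>+x. (\<Sum>i. h x * indicator {y. c m y = i} x) \<partial>\<mu>)"
  proof (intro nn_integral_cong)
    fix x
    have "(\<Sum>i. h x * indicator {y. c m y = i} x) = (\<Sum>i\<in>{c m x}. h x * indicator {y. c m y = i} x)"
      by (rule suminf_finite) auto
    then show "h x = (\<Sum>i. h x * indicator {y. c m y = i} x)" by simp
  qed
  also have "\<dots> = (\<Sum>i. \<integral>\<^sup>+x. h x * indicator {y. c m y = i} x \<partial>\<mu>)"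
    by (rule nn_integral_suminf) measurable
  finally show ?thesis .
qed

text \<open>Averaging over cells is the conditional expectation onto the functions of generation \<open>m\<close>.\<close>

lemma nn_integral_level_cavg:
  assumes \<mu>: "cell_finite \<mu>" and D: "level m D" and h [measurable]: "h \<in> borel_measurable borel"
  shows "(\<integral>\<^sup>+x. D x * h x \<partial>\<mu>) = (\<integral>\<^sup>+x. D x * cavg \<mu> m h x \<partial>\<mu>)"
proof -
  have s [measurable_cong]: "sets \<mu> = sets borel" using \<mu> by (simp add: cell_finite_def)
  have [measurable]: "D \<in> borel_measurable borel" using D by (rule level_measurable)
  have "(\<integral>\<^sup>+x. D x * h x * indicator {y. c m y = i} x \<partial>\<mu>)
      = (\<integral>\<^sup>+x. D x * cavg \<mu> m h x * indicator {y. c m y = i} x \<partial>\<mu>)" for i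
  proof (cases "\<exists>z. c m z = i")
    case True
    then obtain z where z: "{y. c m y = i} = cell m z" "c m z = i" by (auto simp: cell_def)
    have Dz: "D x = D z" "cavg \<mu> m h x = cavg \<mu> m h z" if "x \<in> cell m z" for x
      using that D level_cavg[of m \<mu> h] by (auto simp: cell_def intro: level_cong)
    have "(\<integral>\<^sup>+x. D x * h x * indicator (cell m z) x \<partial>\<mu>) = (\<integral>\<^sup>+x. D z * (h x * indicator (cell m z) x) \<partial>\<mu>)"
    proof (intro nn_integral_cong)
      fix x
      show "D x * h x * indicator (cell m z) x = D z * (h x * indicator (cell m z) x)"
        using Dz[of x] by (cases "x \<in> cell m z") simp_all
    qed
    also have "\<dots> = D z * (\<integral>\<^sup>+x\<in>cell m z. h x \<partial>\<mu>)" by (rule nn_integral_cmult) measurable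
    also have "\<dots> = D z * cavg \<mu> m h z * emeasure \<mu> (cell m z)"
      using cavg_mult_measure[OF \<mu> h] by (simp add: mult.assoc)
    also have "\<dots> = (\<integral>\<^sup>+x. D z * cavg \<mu> m h z * indicator (cell m z) x \<partial>\<mu>)"
      by (subst nn_integral_cmult_indicator) (auto simp: s)
    also have "\<dots> = (\<integral>\<^sup>+x. D x * cavg \<mu> m h x * indicator (cell m z) x \<partial>\<mu>)"
    proof (intro nn_integral_cong)
      fix x
      show "D z * cavg \<mu> m h z * indicator (cell m z) x = D x * cavg \<mu> m h x * indicator (cell m z) x"
        using Dz[of x] by (cases "x \<in> cell m z") simp_all
    qed
    finally show ?thesis by (simp add: z)
  qed (simp add: indicator_def)
  then show ?thesis
    using nn_integral_cells[OF s, of "\<lambda>x. D x * h x" m]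
      nn_integral_cells[OF s, of "\<lambda>x. D x * cavg \<mu> m h x" m] by simp
qed

text \<open>The set is cut into the pieces \<open>S m\<close> on which generation \<open>m\<close> is the first whose average exceeds
  \<open>t\<close>. Such a piece is a union of cells of generation \<open>m\<close>, so on it \<open>h\<close> may be replaced by its
  average, which gives the constant one for every measure.\<close>

lemma maximal_weak_type:
  assumes \<mu>: "cell_finite \<mu>" and h [measurable]: "h \<in> borel_measurable borel"
  shows "t * emeasure \<mu> {x. t < maximal \<mu> h x} \<le> (\<integral>\<^sup>+x. h x \<partial>\<mu>)"
proof -
  have s [measurable_cong]: "sets \<mu> = sets borel" using \<mu> by (simp add: cell_finite_def)
  define S where "S m = {x. t < cavg \<mu> m h x \<and> (\<forall>i<m. \<not> t < cavg \<mu> i h x)}" for m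
  have [measurable]: "S m \<in> sets borel" for m unfolding S_def by measurable
  have disj: "disjoint_family S"
    unfolding disjoint_family_on_def S_def by (auto, metis nat_neq_iff)
  have lev: "level m (indicator (S m))" for m
  proof (rule levelI)
    fix x y assume xy: "c m x = c m y"
    have eq: "cavg \<mu> i h x = cavg \<mu> i h y" if "i \<le> m" for i
      using level_cong[OF level_mono[OF level_cavg that] xy] .
    then have "x \<in> S m \<longleftrightarrow> y \<in> S m"
      using eq[of m] eq[OF order_less_imp_le] unfolding S_def by auto
    then show "indicator (S m) x = (indicator (S m) y :: ennreal)" by (simp add: indicator_def)
  qed
  have "{x. t < maximal \<mu> h x} = (\<Union>m. S m)"
  proof (intro set_eqI iffI)
    fix x assume "x \<in> {x. t < maximal \<mu> h x}"
    then have ex: "\<exists>m. t < cavg \<mu> m h x" by (auto simp: maximal_def less_SUP_iff)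
    then have "x \<in> S (LEAST m. t < cavg \<mu> m h x)"
      unfolding S_def using LeastI_ex[OF ex] not_less_Least by blast
    then show "x \<in> (\<Union>m. S m)" by blast
  qed (auto simp: S_def maximal_def less_SUP_iff)
  then have "t * emeasure \<mu> {x. t < maximal \<mu> h x} = t * (\<Sum>m. emeasure \<mu> (S m))"
    using disj s by (subst suminf_emeasure) auto
  also have "\<dots> = (\<Sum>m. t * emeasure \<mu> (S m))" by simp
  also have "\<dots> \<le> (\<Sum>m. \<integral>\<^sup>+x. indicator (S m) x * h x \<partial>\<mu>)"
  proof (intro suminf_le)
    fix m
    have "t * emeasure \<mu> (S m) = (\<integral>\<^sup>+x. t * indicator (S m) x \<partial>\<mu>)"
      by (subst nn_integral_cmult_indicator) (auto simp: s)
    also have "\<dots> \<le> (\<integral>\<^sup>+x. indicator (S m) x * cavg \<mu> m h x \<partial>\<mu>)"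
      by (intro nn_integral_mono) (auto simp: S_def split: split_indicator)
    also have "\<dots> = (\<integral>\<^sup>+x. indicator (S m) x * h x \<partial>\<mu>)"
      by (rule nn_integral_level_cavg[OF \<mu> lev h, symmetric])
    finally show "t * emeasure \<mu> (S m) \<le> (\<integral>\<^sup>+x. indicator (S m) x * h x \<partial>\<mu>)" .
  qed auto
  also have "\<dots> = (\<integral>\<^sup>+x. (\<Sum>m. indicator (S m) x * h x) \<partial>\<mu>)"
    by (rule nn_integral_suminf[symmetric]) measurable
  also have "\<dots> \<le> (\<integral>\<^sup>+x. h x \<partial>\<mu>)"
  proof (intro nn_integral_mono)
    fix x
    have "(\<Sum>m. indicator (S m) x * h x) = (\<Sum>m. indicator (S m) x) * h x" by simp
    also have "(\<Sum>m. indicator (S m) x) = (indicator (\<Union>m. S m) x :: ennreal)"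
      by (rule suminf_indicator[OF disj])
    also have "\<dots> * h x \<le> 1 * h x" by (intro mult_right_mono) (auto split: split_indicator)
    finally show "(\<Sum>m. indicator (S m) x * h x) \<le> h x" by simp
  qed
  finally show ?thesis .
qed

text \<open>The part of \<open>h\<close> below \<open>t / 2\<close> contributes at most \<open>t / 2\<close> to every average, so only the part above
  it matters, to which the weak type bound is applied at height \<open>t / 2\<close>.\<close>

lemma maximal_level_set:
  assumes \<mu>: "cell_finite \<mu>" and h [measurable]: "h \<in> borel_measurable borel" and t: "0 < t"
  shows "emeasure \<mu> {x. ennreal t < maximal \<mu> h x}
           \<le> ennreal (2 / t) * (\<integral>\<^sup>+x. h x * indicator {x. ennreal t < 2 * h x} x \<partial>\<mu>)"
proof -
  have s [measurable_cong]: "sets \<mu> = sets borel" using \<mu> by (simp add: cell_finite_def)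
  define k where "k x = h x * indicator {x. ennreal t < 2 * h x} x" for x
  have [measurable]: "k \<in> borel_measurable borel" unfolding k_def by measurable
  have tt: "ennreal t = 2 * ennreal (t / 2)" using t by (simp flip: ennreal_mult ennreal_numeral)
  have hk: "h x \<le> k x + ennreal (t / 2)" for x
  proof (cases "ennreal t < 2 * h x")
    case False
    then have "2 * h x \<le> 2 * ennreal (t / 2)" using tt by simp
    then have "h x \<le> ennreal (t / 2)" 
      by (subst (asm) ennreal_mult_le_mult_iff) auto
    then show ?thesis by (simp add: add_increasing)
  qed (simp add: k_def)
  have "cavg \<mu> m h x \<le> cavg \<mu> m k x + ennreal (t / 2)" for m x
  proof -
    have "(\<integral>\<^sup>+y\<in>cell m x. h y \<partial>\<mu>) \<le> (\<integral>\<^sup>+y. k y * indicator (cell m x) y + ennreal (t / 2) * indicator (cell m x) y \<partial>\<mu>)"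
      using hk by (intro nn_integral_mono) (auto split: split_indicator)
    also have "\<dots> = (\<integral>\<^sup>+y\<in>cell m x. k y \<partial>\<mu>) + ennreal (t / 2) * emeasure \<mu> (cell m x)"
      by (subst nn_integral_add) (auto simp: nn_integral_cmult_indicator s)
    finally have "cavg \<mu> m h x \<le> ((\<integral>\<^sup>+y\<in>cell m x. k y \<partial>\<mu>) + ennreal (t / 2) * emeasure \<mu> (cell m x)) / emeasure \<mu> (cell m x)"
      unfolding cavg_def by (rule divide_right_mono_ennreal)
    also have "\<dots> = cavg \<mu> m k x + ennreal (t / 2) * emeasure \<mu> (cell m x) / emeasure \<mu> (cell m x)"
      by (simp add: add_divide_distrib_ennreal cavg_def)
    also have "ennreal (t / 2) * emeasure \<mu> (cell m x) / emeasure \<mu> (cell m x) \<le> ennreal (t / 2)"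
      by (cases "emeasure \<mu> (cell m x) = 0"; cases "emeasure \<mu> (cell m x) = top")
         (auto simp: ennreal_mult_divide_eq)
    finally show ?thesis by (simp add: add_left_mono)
  qed
  then have "maximal \<mu> h x \<le> maximal \<mu> k x + ennreal (t / 2)" for x
    unfolding maximal_def[of \<mu> h] by (intro SUP_least) (metis add_right_mono cavg_le_maximal order_trans)
  then have "{x. ennreal t < maximal \<mu> h x} \<subseteq> {x. ennreal (t / 2) < maximal \<mu> k x}"
  proof safe
    fix x assume le: "\<And>x. maximal \<mu> h x \<le> maximal \<mu> k x + ennreal (t / 2)" and "ennreal t < maximal \<mu> h x"
    then have "ennreal t < maximal \<mu> k x + ennreal (t / 2)" by (metis order.strict_trans2)
    moreover have "ennreal t = ennreal (t / 2) + ennreal (t / 2)" using t by (simp flip: ennreal_plus)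
    ultimately show "ennreal (t / 2) < maximal \<mu> k x"
      by (metis add_right_mono leD leI)
  qed
  then have "emeasure \<mu> {x. ennreal t < maximal \<mu> h x} \<le> emeasure \<mu> {x. ennreal (t / 2) < maximal \<mu> k x}"
    by (rule emeasure_mono) (simp add: s)
  also have "\<dots> = ennreal (2 / t) * (ennreal (t / 2) * emeasure \<mu> {x. ennreal (t / 2) < maximal \<mu> k x})"
    using t by (simp add: mult.assoc[symmetric] flip: ennreal_mult)
  also have "\<dots> \<le> ennreal (2 / t) * (\<integral>\<^sup>+x. k x \<partial>\<mu>)"
    by (intro mult_left_mono maximal_weak_type \<mu>) auto
  finally show ?thesis by (simp add: k_def)
qed

text \<open>Integrating the level set estimate against \<open>layer_density p\<close> and exchanging the integrals. Since
  that estimate bounds the level sets by \<open>h\<close> alone, finiteness of the left-hand side is obtained and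
  not presupposed. The constant depends on \<open>p\<close> alone, not on the measure.\<close>

theorem maximal_strong_type:
  assumes \<mu>: "cell_finite \<mu>" and h [measurable]: "h \<in> borel_measurable borel" and p: "1 < p"
  shows "(\<integral>\<^sup>+x. ennpowr (maximal \<mu> h x) p \<partial>\<mu>)
           \<le> ennreal (2 powr p * p / (p - 1)) * (\<integral>\<^sup>+x. ennpowr (h x) p \<partial>\<mu>)"
proof -
  have s [measurable_cong]: "sets \<mu> = sets borel" using \<mu> by (simp add: cell_finite_def)
  have sp: "space \<mu> = UNIV" using sets_eq_imp_space_eq[OF s] by simp
  note sf = sigma_finite_of_cell_finite[OF \<mu>]
  interpret sigma_finite_measure \<mu> by (rule sf)
  have "(\<integral>\<^sup>+x. ennpowr (maximal \<mu> h x) p \<partial>\<mu>)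
      = (\<integral>\<^sup>+t. layer_density p t * emeasure \<mu> {x. ennreal t < maximal \<mu> h x} \<partial>lborel)"
    using nn_integral_layer_cake[OF sf, of p "maximal \<mu> h" "\<lambda>_. 1"] p by (simp add: sp s)
  also have "\<dots> \<le> (\<integral>\<^sup>+t. ennreal (2 * p / (p - 1)) * (layer_density (p - 1) t *
        (\<integral>\<^sup>+x. h x * indicator {x \<in> space \<mu>. ennreal t < 2 * h x} x \<partial>\<mu>)) \<partial>lborel)"
  proof (intro nn_integral_mono)
    fix t :: real
    show "layer_density p t * emeasure \<mu> {x. ennreal t < maximal \<mu> h x} \<le>
      ennreal (2 * p / (p - 1)) * (layer_density (p - 1) t *
        (\<integral>\<^sup>+x. h x * indicator {x \<in> space \<mu>. ennreal t < 2 * h x} x \<partial>\<mu>))"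
    proof (cases "0 < t")
      case True
      have "t powr (p - 1) = t * t powr (p - 1 - 1)" using True powr_add[of t 1 "p - 1 - 1"] by simp
      then have eq: "layer_density p t * ennreal (2 / t) = ennreal (2 * p / (p - 1)) * layer_density (p - 1) t"
        using True p by (simp add: layer_density_def flip: ennreal_mult)
      have "layer_density p t * emeasure \<mu> {x. ennreal t < maximal \<mu> h x}
         \<le> layer_density p t * (ennreal (2 / t) * (\<integral>\<^sup>+x. h x * indicator {x. ennreal t < 2 * h x} x \<partial>\<mu>))"
        by (intro mult_left_mono maximal_level_set \<mu> h True) auto
      then show ?thesis by (simp add: mult.assoc[symmetric] eq sp)
    qed (simp add: layer_density_def)
  qed
  also have "\<dots> = ennreal (2 * p / (p - 1)) * (\<integral>\<^sup>+x. h x * ennpowr (2 * h x) (p - 1) \<partial>\<mu>)"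
    using p by (subst nn_integral_cmult) (auto simp: nn_integral_layer_cake[OF sf])
  also have "(\<integral>\<^sup>+x. h x * ennpowr (2 * h x) (p - 1) \<partial>\<mu>)
      = (\<integral>\<^sup>+x. ennreal (2 powr (p - 1)) * ennpowr (h x) p \<partial>\<mu>)"
  proof (intro nn_integral_cong)
    fix x
    have "ennpowr (h x) p = h x * ennpowr (h x) (p - 1)"
      using ennpowr_add[of 1 "p - 1" "h x"] p by simp
    moreover have "ennpowr 2 (p - 1) = ennreal (2 powr (p - 1))"
      using ennpowr_ennreal_pos[of 2 "p - 1"] by simp
    ultimately show "h x * ennpowr (2 * h x) (p - 1) = ennreal (2 powr (p - 1)) * ennpowr (h x) p"
      using p by (simp add: ennpowr_mult mult_ac)
  qed
  also have "\<dots> = ennreal (2 powr (p - 1)) * (\<integral>\<^sup>+x. ennpowr (h x) p \<partial>\<mu>)"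
    by (rule nn_integral_cmult) measurable
  also have "ennreal (2 * p / (p - 1)) * (ennreal (2 powr (p - 1)) * (\<integral>\<^sup>+x. ennpowr (h x) p \<partial>\<mu>))
      = ennreal (2 * p / (p - 1) * 2 powr (p - 1)) * (\<integral>\<^sup>+x. ennpowr (h x) p \<partial>\<mu>)"
    using p by (subst ennreal_mult) (auto simp: mult.assoc)
  also have "2 * p / (p - 1) * 2 powr (p - 1) = 2 powr p * p / (p - 1)"
    using powr_add[of 2 1 "p - 1"] by simp
  finally show ?thesis .
qed

end

section \<open>Running maxima and Abel summation\<close>

lemma ennreal_inverse_antimono: "s \<le> t \<Longrightarrow> inverse t \<le> inverse (s :: ennreal)"
proof (cases s; cases t)
  fix a b assume "s \<le> t" "s = ennreal a" "t = ennreal b" "0 \<le> a" "0 \<le> b"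
  then show ?thesis by (cases "a = 0") (simp_all add: inverse_ennreal ennreal_leI)
qed (auto simp: top_unique)

primrec running_max :: "(nat \<Rightarrow> ennreal) \<Rightarrow> nat \<Rightarrow> ennreal" where
  "running_max a 0 = a 0"
| "running_max a (Suc m) = max (running_max a m) (a (Suc m))"

text \<open>The case distinction keeps the increment \<open>0\<close> after the running maximum has reached \<open>\<infinity>\<close>, where
  \<open>\<infinity> - \<infinity> = \<infinity>\<close> in \<^typ>\<open>ennreal\<close>.\<close>

primrec increment :: "(nat \<Rightarrow> ennreal) \<Rightarrow> nat \<Rightarrow> ennreal" where
  "increment a 0 = a 0"
| "increment a (Suc m) = (if a (Suc m) \<le> running_max a m then 0 else a (Suc m) - running_max a m)"

lemma le_running_max: "k \<le> m \<Longrightarrow> a k \<le> running_max a m"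
  by (induction m) (auto simp: le_Suc_eq le_max_iff_disj)

lemma running_max_le: "(\<And>k. a k \<le> t) \<Longrightarrow> running_max a m \<le> t"
  by (induction m) auto

lemma sum_increment: "(\<Sum>j\<le>m. increment a j) = running_max a m"
proof (induction m)
  case (Suc m)
  show ?case
    using add_diff_inverse_ennreal[of "running_max a m" "a (Suc m)"]
    by (cases "a (Suc m) \<le> running_max a m") (simp_all add: Suc max_absorb1 max_absorb2)
qed simp

lemma running_max_eq_of_increment: "increment a m \<noteq> 0 \<Longrightarrow> running_max a m = a m"
  by (cases m) (auto simp: max_def split: if_splits)

lemma increment_cong:
  assumes "\<And>k. k \<le> m \<Longrightarrow> a k = b k"
  shows "increment a m = increment b m \<and> running_max a m = running_max b m"
  using assms by (induction m) auto

lemma suminf_increment_le: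
  assumes "\<And>k. a k \<le> t"
  shows "(\<Sum>j. increment a j) \<le> t"
proof (rule suminf_le_const)
  fix n
  have "sum (increment a) {..<n} \<le> sum (increment a) {..n}"
    by (intro sum_mono2) auto
  also have "\<dots> \<le> t" unfolding sum_increment using assms by (rule running_max_le)
  finally show "sum (increment a) {..<n} \<le> t" .
qed simp

lemma suminf_swap_ennreal: "(\<Sum>i. \<Sum>j. f i j) = (\<Sum>j. \<Sum>i. f i j :: ennreal)"
  using nn_integral_suminf[of "\<lambda>j i. f i j" "count_space UNIV"]
  by (simp add: nn_integral_count_space_nat)

text \<open>Abel summation: the sequence is replaced by its running maximum, which is the sum of its increments,
  and the factors \<open>r\<close> are summed first, where the assumption collapses each tail to its first term. 
  Only those generations survive at which a new maximum is attained; they take the role of the stopping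
  cubes of a sparse family.\<close>

lemma suminf_le_increments:
  fixes a r :: "nat \<Rightarrow> ennreal"
  assumes r: "\<And>j. (\<Sum>m. if j \<le> m then r m else 0) \<le> C * r j"
  shows "(\<Sum>m. r m * a m) \<le> C * (\<Sum>j. r j * increment a j)"
proof -
  have "(\<Sum>m. r m * a m) \<le> (\<Sum>m. r m * running_max a m)"
    by (intro suminf_le mult_left_mono) (auto simp: le_running_max)
  also have "\<dots> = (\<Sum>m. \<Sum>j. (if j \<le> m then r m else 0) * increment a j)"
  proof (intro suminf_cong)
    fix m
    have "(\<Sum>j. (if j \<le> m then r m else 0) * increment a j)
        = (\<Sum>j\<le>m. (if j \<le> m then r m else 0) * increment a j)"
      by (rule suminf_finite) auto
    also have "\<dots> = r m * running_max a m"
      by (simp add: sum_distrib_left flip: sum_increment)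
    finally show "r m * running_max a m = (\<Sum>j. (if j \<le> m then r m else 0) * increment a j)" by simp
  qed
  also have "\<dots> = (\<Sum>j. \<Sum>m. (if j \<le> m then r m else 0) * increment a j)"
    by (rule suminf_swap_ennreal)
  also have "\<dots> = (\<Sum>j. (\<Sum>m. if j \<le> m then r m else 0) * increment a j)"
    by (simp only: ennreal_suminf_multc)
  also have "\<dots> \<le> (\<Sum>j. C * r j * increment a j)"
    by (intro suminf_le mult_right_mono r) auto
  also have "\<dots> = C * (\<Sum>j. r j * increment a j)"
    by (simp only: mult.assoc ennreal_suminf_cmult)
  finally show ?thesis .
qed

context nested_partition
begin

lemma cavg_indicator:
  assumes "m \<le> k" "y \<in> cell m x"
  shows "cavg \<mu> k (\<lambda>z. h z * indicator (cell m x) z) y = cavg \<mu> k h y"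
proof -
  have "(\<integral>\<^sup>+z\<in>cell k y. h z * indicator (cell m x) z \<partial>\<mu>) = (\<integral>\<^sup>+z\<in>cell k y. h z \<partial>\<mu>)"
    using cell_subset[OF assms] by (intro nn_integral_cong) (auto split: split_indicator)
  then show ?thesis by (simp add: cavg_def)
qed

text \<open>When generation \<open>m\<close> sets a new maximum at \<open>x\<close>, coarser averages on the cell are no larger than the
  present one. Points at which the maximal function exceeds twice that value owe this to finer cells,
  hence to \<open>F\<close> restricted to the cell, and the weak type bound makes them fill at most half of it.\<close>

lemma maximal_le_twice_on_half:
  assumes \<nu>: "cell_finite \<nu>" and F [measurable]: "F \<in> borel_measurable borel"
    and fin: "cavg \<nu> m F x < top"
    and inc: "increment (\<lambda>k. cavg \<nu> k F x) m \<noteq> 0"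
  shows "emeasure \<nu> (cell m x) \<le> 2 * emeasure \<nu> {y \<in> cell m x. maximal \<nu> F y \<le> 2 * cavg \<nu> m F x}"
proof -
  have s [measurable_cong]: "sets \<nu> = sets borel" using \<nu> by (simp add: cell_finite_def)
  define a where "a = cavg \<nu> m F x"
  define Q where "Q = cell m x"
  define G where "G = {y \<in> Q. maximal \<nu> F y \<le> 2 * a}"
  define B where "B = {y \<in> Q. 2 * a < maximal \<nu> F y}"
  have [measurable]: "Q \<in> sets borel" by (simp add: Q_def)
  have [measurable]: "G \<in> sets borel" "B \<in> sets borel" unfolding G_def B_def by measurable
  have rm: "running_max (\<lambda>k. cavg \<nu> k F x) m = a"
    using running_max_eq_of_increment[OF inc] by (simp add: a_def)
  have a0: "a \<noteq> 0"
    using rm inc sum_increment[of "\<lambda>k. cavg \<nu> k F x" m] by auto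
  obtain r where r: "a = ennreal r" "0 < r"
    using a0 fin unfolding a_def[symmetric] by (metis ennreal_cases ennreal_0 less_eq_real_def less_irrefl)
  have sub: "B \<subseteq> {y. 2 * a < maximal \<nu> (\<lambda>z. F z * indicator Q z) y}"
  proof
    fix y assume "y \<in> B"
    then have y: "y \<in> cell m x" "2 * a < maximal \<nu> F y" by (auto simp: B_def Q_def)
    then obtain k where k: "2 * a < cavg \<nu> k F y" by (auto simp: maximal_def less_SUP_iff)
    have "m < k"
    proof (rule ccontr)
      assume "\<not> m < k"
      then have km: "k \<le> m" by simp
      have "c m y = c m x" using y by (simp add: cell_def)
      then have "cavg \<nu> k F y = cavg \<nu> k F x"
        by (rule level_cong[OF level_mono[OF level_cavg km]])
      also have "\<dots> \<le> a" using le_running_max[OF km, of "\<lambda>k. cavg \<nu> k F x"] rm by simp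
      also have "\<dots> \<le> 2 * a" using mult_right_mono[of 1 2 a] by simp
      finally show False using k by simp
    qed
    then have "cavg \<nu> k (\<lambda>z. F z * indicator Q z) y = cavg \<nu> k F y"
      unfolding Q_def using y by (intro cavg_indicator) auto
    with k have "2 * a < maximal \<nu> (\<lambda>z. F z * indicator Q z) y"
      by (metis cavg_le_maximal order.strict_trans2)
    then show "y \<in> {y. 2 * a < maximal \<nu> (\<lambda>z. F z * indicator Q z) y}" by simp
  qed
  have "2 * a * emeasure \<nu> B \<le> 2 * a * emeasure \<nu> {y. 2 * a < maximal \<nu> (\<lambda>z. F z * indicator Q z) y}"
    using sub s by (intro mult_left_mono emeasure_mono) auto
  also have "\<dots> \<le> (\<integral>\<^sup>+z. F z * indicator Q z \<partial>\<nu>)"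
    by (intro maximal_weak_type \<nu>) measurable
  also have "\<dots> = a * emeasure \<nu> Q"
    using cavg_mult_measure[OF \<nu> F, of m x] by (simp add: a_def Q_def)
  finally have "a * (2 * emeasure \<nu> B) \<le> a * emeasure \<nu> Q" by (simp add: mult_ac)
  then have B: "2 * emeasure \<nu> B \<le> emeasure \<nu> Q"
    using r by (subst (asm) ennreal_mult_le_mult_iff) auto
  have "emeasure \<nu> Q = emeasure \<nu> G + emeasure \<nu> B"
    by (subst plus_emeasure) (auto simp: s G_def B_def intro!: arg_cong[where f = "emeasure \<nu>"])
  moreover have "emeasure \<nu> Q < top" using \<nu> by (simp add: cell_finite_def Q_def)
  ultimately have "emeasure \<nu> Q \<le> 2 * emeasure \<nu> G"
    using B by (cases "emeasure \<nu> G"; cases "emeasure \<nu> B")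
      (auto simp flip: ennreal_plus ennreal_numeral ennreal_mult)
  then show ?thesis by (simp add: G_def Q_def a_def)
qed

text \<open>The substitute for the large disjoint parts of sparse cubes: the increment divided by the maximal
  function sums to at most one over the generations, and its mean over the cell is at least a quarter of
  the increment divided by the average.\<close>

lemma cavg_inverse_maximal:
  assumes \<nu>: "cell_finite \<nu>" and F [measurable]: "F \<in> borel_measurable borel"
    and pos: "0 < emeasure \<nu> (cell m x)"
    and fin: "cavg \<nu> m F x < top"
    and inc: "increment (\<lambda>k. cavg \<nu> k F x) m \<noteq> 0"
  shows "1 \<le> 4 * cavg \<nu> m F x * cavg \<nu> m (\<lambda>y. inverse (maximal \<nu> F y)) x"
proof -
  have s [measurable_cong]: "sets \<nu> = sets borel" using \<nu> by (simp add: cell_finite_def)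
  define a where "a = cavg \<nu> m F x"
  define Q where "Q = cell m x"
  define G where "G = {y \<in> Q. maximal \<nu> F y \<le> 2 * a}"
  have [measurable]: "Q \<in> sets borel" by (simp add: Q_def)
  have [measurable]: "G \<in> sets borel" unfolding G_def by measurable
  have half: "emeasure \<nu> Q \<le> 2 * emeasure \<nu> G"
    using maximal_le_twice_on_half[OF \<nu> F fin inc] by (simp add: G_def Q_def a_def)
  have QQ: "emeasure \<nu> Q \<noteq> 0" "emeasure \<nu> Q \<noteq> top"
    using \<nu> pos by (auto simp: cell_finite_def Q_def less_top)
  have a0: "a \<noteq> 0"
    using running_max_eq_of_increment[OF inc] inc sum_increment[of "\<lambda>k. cavg \<nu> k F x" m]
    by (auto simp: a_def)
  obtain r where r: "a = ennreal r" "0 < r"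
    using a0 fin unfolding a_def[symmetric] by (metis ennreal_cases ennreal_0 less_eq_real_def less_irrefl)
  have inv: "4 * a * inverse (2 * a) = 2"
    using r by (simp add: inverse_ennreal flip: ennreal_numeral ennreal_mult)
  have "inverse (2 * a) * emeasure \<nu> G = (\<integral>\<^sup>+y. inverse (2 * a) * indicator G y \<partial>\<nu>)"
    by (subst nn_integral_cmult_indicator) (auto simp: s)
  also have "\<dots> \<le> (\<integral>\<^sup>+y. inverse (maximal \<nu> F y) * indicator Q y \<partial>\<nu>)"
    by (intro nn_integral_mono) (auto simp: G_def ennreal_inverse_antimono split: split_indicator)
  also have "\<dots> = cavg \<nu> m (\<lambda>y. inverse (maximal \<nu> F y)) x * emeasure \<nu> Q"
    unfolding Q_def by (rule cavg_mult_measure[OF \<nu>, symmetric]) measurable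
  finally have le: "inverse (2 * a) * emeasure \<nu> G
      \<le> cavg \<nu> m (\<lambda>y. inverse (maximal \<nu> F y)) x * emeasure \<nu> Q" .
  have "emeasure \<nu> Q \<le> 4 * a * (inverse (2 * a) * emeasure \<nu> G)"
    using half inv by (simp add: mult.assoc[symmetric])
  also have "\<dots> \<le> 4 * a * (cavg \<nu> m (\<lambda>y. inverse (maximal \<nu> F y)) x * emeasure \<nu> Q)"
    using le by (rule mult_left_mono) simp
  also have "\<dots> = emeasure \<nu> Q * (4 * a * cavg \<nu> m (\<lambda>y. inverse (maximal \<nu> F y)) x)"
    by (simp only: mult_ac)
  finally have "emeasure \<nu> Q * 1 \<le> emeasure \<nu> Q * (4 * a * cavg \<nu> m (\<lambda>y. inverse (maximal \<nu> F y)) x)"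
    by simp
  then show ?thesis
    using QQ by (subst (asm) ennreal_mult_le_mult_iff) (auto simp: a_def)
qed

lemma measure_times_cavg_Hoelder:
  assumes \<mu>: "cell_finite \<mu>" and h [measurable]: "h \<in> borel_measurable borel"
    and p: "1 < p" "1 < p'" "1 / p + 1 / p' = 1"
  shows "cavg \<mu> m h x * ennpowr (emeasure \<mu> (cell m x)) (1 / p)
      \<le> ennpowr (\<integral>\<^sup>+y. ennpowr (h y) p \<partial>\<mu>) (1 / p)"
proof (cases "emeasure \<mu> (cell m x) = 0")
  case True
  then show ?thesis using p by simp
next
  case False
  have s [measurable_cong]: "sets \<mu> = sets borel" using \<mu> by (simp add: cell_finite_def)
  define N where "N = ennpowr (\<integral>\<^sup>+y. ennpowr (h y) p \<partial>\<mu>) (1 / p)"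
  define t where "t = emeasure \<mu> (cell m x)"
  have t: "t \<noteq> 0" "t \<noteq> top" using False \<mu> by (auto simp: t_def cell_finite_def less_top)
  have "cavg \<mu> m h x * t = (\<integral>\<^sup>+y\<in>cell m x. h y \<partial>\<mu>)"
    unfolding t_def by (rule cavg_mult_measure[OF \<mu> h])
  also have "\<dots> \<le> N * ennpowr (\<integral>\<^sup>+y. ennpowr (indicator (cell m x) y) p' \<partial>\<mu>) (1 / p')"
    unfolding N_def by (rule nn_integral_Hoelder[OF p]) measurable
  also have "(\<integral>\<^sup>+y. ennpowr (indicator (cell m x) y) p' \<partial>\<mu>) = (\<integral>\<^sup>+y. indicator (cell m x) y \<partial>\<mu>)"
    using p by (intro nn_integral_cong) (simp split: split_indicator)
  also have "\<dots> = t" by (simp add: t_def s)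
  finally have le: "cavg \<mu> m h x * t \<le> N * ennpowr t (1 / p')" .
  have "t = ennpowr t (1 / p) * ennpowr t (1 / p')"
    using p ennpowr_add[of "1 / p" "1 / p'" t] by simp
  then have "cavg \<mu> m h x * t = ennpowr t (1 / p') * (cavg \<mu> m h x * ennpowr t (1 / p))"
    by (metis mult.assoc mult.commute)
  with le have "ennpowr t (1 / p') * (cavg \<mu> m h x * ennpowr t (1 / p)) \<le> ennpowr t (1 / p') * N"
    by (simp add: mult.commute)
  then have "cavg \<mu> m h x * ennpowr t (1 / p) \<le> N"
    using t p by (subst (asm) ennreal_mult_le_mult_iff) (auto simp: ennpowr_eq_0_iff ennpowr_eq_top_iff)
  then show ?thesis by (simp add: N_def t_def)
qed

text \<open>The fractional maximal function is controlled by the ordinary one, by splitting the average as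
  \<open>E = E powr (p / q) * E powr (1 - p / q)\<close> and using Hoelder's inequality on the second factor. The
  power of the measure of the cell cancels exactly when the exponent is \<open>1 / p - 1 / q\<close>.\<close>

lemma fractional_cavg_le_maximal:
  assumes \<mu>: "cell_finite \<mu>" and h [measurable]: "h \<in> borel_measurable borel"
    and p: "1 < p" "p < q"
  shows "ennpowr (emeasure \<mu> (cell m x)) (1 / p - 1 / q) * cavg \<mu> m h x
      \<le> ennpowr (ennpowr (\<integral>\<^sup>+y. ennpowr (h y) p \<partial>\<mu>) (1 / p)) (1 - p / q) * ennpowr (maximal \<mu> h x) (p / q)"
proof -
  define E where "E = cavg \<mu> m h x"
  define t where "t = emeasure \<mu> (cell m x)"
  define N where "N = ennpowr (\<integral>\<^sup>+y. ennpowr (h y) p \<partial>\<mu>) (1 / p)"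
  have e: "0 < 1 - p / q" "0 < p / q" "0 < 1 / p" using p by (auto simp: field_simps)
  have e1: "1 / p * (1 - p / q) = 1 / p - 1 / q" using p by (simp add: field_simps)
  have conj: "1 < p / (p - 1)" "1 / p + 1 / (p / (p - 1)) = 1" using p by (auto simp: field_simps)
  have "ennpowr t (1 / p - 1 / q) * E = ennpowr (ennpowr t (1 / p)) (1 - p / q) * (ennpowr E (1 - p / q) * ennpowr E (p / q))"
    using e e1 ennpowr_add[OF e(1,2), of E] by (simp add: ennpowr_ennpowr)
  also have "\<dots> = ennpowr (E * ennpowr t (1 / p)) (1 - p / q) * ennpowr E (p / q)"
    using e by (simp add: ennpowr_mult mult_ac)
  also have "\<dots> \<le> ennpowr N (1 - p / q) * ennpowr (maximal \<mu> h x) (p / q)"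
    using measure_times_cavg_Hoelder[OF \<mu> h p(1) conj, of m x] cavg_le_maximal[of \<mu> m h x] e
    by (intro mult_mono ennpowr_mono) (auto simp: E_def t_def N_def)
  finally show ?thesis by (simp add: E_def t_def N_def)
qed

text \<open>Here \<open>V m\<close> is the common measure of the cells of generation \<open>m\<close>, and \<open>b\<close> stands for
  \<open>1 - \<alpha> / n\<close>. On a cell \<open>Q\<close>, the averages of \<open>f * \<sigma>\<close> and \<open>g * u\<close> are the \<open>\<sigma>\<close>-average of \<open>f\<close> and
  the \<open>u\<close>-average of \<open>g\<close> times the averages of \<open>\<sigma>\<close> and \<open>u\<close>. The weight condition absorbs \<open>u\<close> and
  the power \<open>b\<close> of \<open>\<sigma>\<close> at the price of one factor \<open>W\<close>; the remaining power \<open>1 - b\<close> of \<open>\<sigma>\<close> joins the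
  factor \<open>V m powr (1 - b)\<close> to \<open>\<sigma>(Q) powr (1 - b)\<close>, which is what a fractional average in \<open>L\<^sup>p(\<sigma>)\<close>
  requires. The sum over the generations is replaced by a supremum with the help of the increments, and
  the integral that remains is a product of two maximal functions, split by Hoelder's inequality through
  \<open>dual\<close>.\<close>

theorem bilinear_estimate:
  fixes \<nu> :: "'a measure" and V :: "nat \<Rightarrow> real" and u \<sigma> :: "'a \<Rightarrow> real" and f g :: "'a \<Rightarrow> ennreal"
  assumes \<nu>: "cell_finite \<nu>"
    and V: "\<And>m. 0 < V m" "\<And>m x. emeasure \<nu> (cell m x) = ennreal (V m)"
    and b: "0 < b" "b < 1" and p: "1 < p" "p < q" "1 / p - 1 / q = 1 - b"
    and q: "1 < q" "1 < q'" "1 / q + 1 / q' = 1"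
    and C: "\<And>j. (\<Sum>m. if j \<le> m then ennreal (V m powr (1 - b)) else 0) \<le> C * ennreal (V j powr (1 - b))"
    and u [measurable]: "u \<in> borel_measurable borel" "\<And>x. 0 < u x"
    and \<sigma> [measurable]: "\<sigma> \<in> borel_measurable borel" "\<And>x. 0 < \<sigma> x"
    and dual: "\<And>x. \<sigma> x powr (1 / q) * u x powr (1 / q') = 1"
    and fin_u: "cell_finite (density \<nu> (\<lambda>x. ennreal (u x)))"
    and fin_\<sigma>: "cell_finite (density \<nu> (\<lambda>x. ennreal (\<sigma> x)))"
    and W: "\<And>m x. cavg \<nu> m (\<lambda>x. ennreal (u x)) x * ennpowr (cavg \<nu> m (\<lambda>x. ennreal (\<sigma> x)) x) b \<le> W"
    and f [measurable]: "f \<in> borel_measurable borel" and g [measurable]: "g \<in> borel_measurable borel"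
    and f_fin: "(\<integral>\<^sup>+x. ennpowr (f x) p * \<sigma> x \<partial>\<nu>) < top"
  shows "(\<integral>\<^sup>+x. (\<Sum>m. ennreal (V m powr (1 - b)) * cavg \<nu> m (\<lambda>y. f y * \<sigma> y) x) * (g x * u x) \<partial>\<nu>)
    \<le> 4 * C * W * ennreal ((2 powr p * p / (p - 1)) powr (1 / q) * (2 powr q' * q' / (q' - 1)) powr (1 / q'))
        * ennpowr (\<integral>\<^sup>+x. ennpowr (f x) p * \<sigma> x \<partial>\<nu>) (1 / p) * ennpowr (\<integral>\<^sup>+x. ennpowr (g x) q' * u x \<partial>\<nu>) (1 / q')"
proof -
  have s [measurable_cong]: "sets \<nu> = sets borel" using \<nu> by (simp add: cell_finite_def)
  define R where "R m = ennreal (V m powr (1 - b))" for m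
  define F where "F x = f x * \<sigma> x" for x
  define G where "G x = g x * u x" for x
  define \<mu>u where "\<mu>u = density \<nu> (\<lambda>x. ennreal (u x))"
  define \<mu>s where "\<mu>s = density \<nu> (\<lambda>x. ennreal (\<sigma> x))"
  define M where "M = maximal \<nu> F"
  define D where "D m x = increment (\<lambda>k. cavg \<nu> k F x) m" for m x
  define \<Phi> where "\<Phi> m x = ennpowr (emeasure \<mu>s (cell m x)) (1 - b) * cavg \<mu>s m f x * cavg \<mu>u m g x" for m x
  define Nf where "Nf = ennpowr (\<integral>\<^sup>+x. ennpowr (f x) p \<partial>\<mu>s) (1 / p)"
  have [measurable]: "F \<in> borel_measurable borel" "G \<in> borel_measurable borel" unfolding F_def G_def by measurable
  have [measurable]: "M \<in> borel_measurable borel" unfolding M_def by measurable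
  have cu: "cell_finite \<mu>u" and cs: "cell_finite \<mu>s"
    using fin_u fin_\<sigma> by (auto simp: \<mu>u_def \<mu>s_def)
  have int_u: "(\<integral>\<^sup>+x. h x \<partial>\<mu>u) = (\<integral>\<^sup>+x. h x * u x \<partial>\<nu>)"
    and int_s: "(\<integral>\<^sup>+x. h x \<partial>\<mu>s) = (\<integral>\<^sup>+x. h x * \<sigma> x \<partial>\<nu>)" if [measurable]: "h \<in> borel_measurable borel" for h
    unfolding \<mu>u_def \<mu>s_def by (simp_all add: nn_integral_density mult.commute)
  have levD: "level m (D m)" for m
  proof (rule levelI)
    fix x y assume xy: "c m x = c m y"
    have "cavg \<nu> k F x = cavg \<nu> k F y" if "k \<le> m" for k
      using level_cong[OF level_mono[OF level_cavg that] xy] .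
    then show "D m x = D m y"
      unfolding D_def using increment_cong[of m "\<lambda>k. cavg \<nu> k F x" "\<lambda>k. cavg \<nu> k F y"] by simp
  qed
  have lev\<Phi>: "level m (\<Phi> m)" for m
  proof (rule levelI)
    fix x y assume xy: "c m x = c m y"
    show "\<Phi> m x = \<Phi> m y"
      unfolding \<Phi>_def cell_eq[OF xy] level_cong[OF level_cavg xy] ..
  qed
  have [measurable]: "D m \<in> borel_measurable borel" "\<Phi> m \<in> borel_measurable borel" for m
    using levD lev\<Phi> by (auto intro: level_measurable)
  have sumD: "(\<Sum>m. D m x) \<le> M x" for x
    unfolding D_def M_def by (intro suminf_increment_le cavg_le_maximal)
  have Fcell: "cavg \<nu> m F x * V m = cavg \<mu>s m f x * emeasure \<mu>s (cell m x)"
    and Gcell: "cavg \<nu> m G x * V m = cavg \<mu>u m g x * emeasure \<mu>u (cell m x)" for m x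
  proof -
    have "cavg \<nu> m F x * V m = (\<integral>\<^sup>+y\<in>cell m x. F y \<partial>\<nu>)"
      using cavg_mult_measure[OF \<nu>, of F m x] by (simp add: V)
    also have "\<dots> = (\<integral>\<^sup>+y\<in>cell m x. f y \<partial>\<mu>s)"
      by (subst int_s) (auto simp: F_def mult_ac)
    also have "\<dots> = cavg \<mu>s m f x * emeasure \<mu>s (cell m x)"
      by (rule cavg_mult_measure[OF cs f, symmetric])
    finally show "cavg \<nu> m F x * V m = cavg \<mu>s m f x * emeasure \<mu>s (cell m x)" .
    have "cavg \<nu> m G x * V m = (\<integral>\<^sup>+y\<in>cell m x. G y \<partial>\<nu>)"
      using cavg_mult_measure[OF \<nu>, of G m x] by (simp add: V)
    also have "\<dots> = (\<integral>\<^sup>+y\<in>cell m x. g y \<partial>\<mu>u)"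
      by (subst int_u) (auto simp: G_def mult_ac)
    also have "\<dots> = cavg \<mu>u m g x * emeasure \<mu>u (cell m x)"
      by (rule cavg_mult_measure[OF cu g, symmetric])
    finally show "cavg \<nu> m G x * V m = cavg \<mu>u m g x * emeasure \<mu>u (cell m x)" .
  qed
  have scell: "emeasure \<mu>s (cell m x) = cavg \<nu> m (\<lambda>x. ennreal (\<sigma> x)) x * V m"
    and ucell: "emeasure \<mu>u (cell m x) = cavg \<nu> m (\<lambda>x. ennreal (u x)) x * V m" for m x
    using cavg_mult_measure[OF \<nu>, of "\<lambda>x. ennreal (\<sigma> x)" m x] cavg_mult_measure[OF \<nu>, of "\<lambda>x. ennreal (u x)" m x]
    by (auto simp: \<mu>u_def \<mu>s_def V emeasure_density s)
  have cancelV: "s1 = s2" if "s1 * ennreal (V m) = s2 * ennreal (V m)" for s1 s2 m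
    using that V(1)[of m] by (metis ennreal_mult_divide_eq ennreal_neq_top ennreal_eq_0_iff not_less)
  have cavgF: "cavg \<nu> m F x = cavg \<mu>s m f x * cavg \<nu> m (\<lambda>x. ennreal (\<sigma> x)) x"
    and cavgG: "cavg \<nu> m G x = cavg \<mu>u m g x * cavg \<nu> m (\<lambda>x. ennreal (u x)) x" for m x
    using Fcell[of m x] Gcell[of m x] unfolding scell ucell mult.assoc[symmetric]
    by (auto dest: cancelV)
  have finF: "cavg \<nu> m F x < top" for m x
  proof -
    have conj: "1 < p / (p - 1)" "1 / p + 1 / (p / (p - 1)) = 1" using p by (auto simp: field_simps)
    have Nf: "Nf < top" unfolding Nf_def using f_fin p by (subst ennpowr_less_top_iff) (auto simp: int_s)
    have pos: "0 < emeasure \<mu>s (cell m x)"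
    proof (rule ccontr)
      assume "\<not> 0 < emeasure \<mu>s (cell m x)"
      then have "(\<integral>\<^sup>+y. ennreal (\<sigma> y) * indicator (cell m x) y \<partial>\<nu>) = 0"
        unfolding \<mu>s_def by (simp add: emeasure_density s)
      then have "AE y in \<nu>. ennreal (\<sigma> y) * indicator (cell m x) y = 0"
        by (subst (asm) nn_integral_0_iff_AE) auto
      then have "AE y in \<nu>. y \<notin> cell m x"
      proof eventually_elim
        case (elim y)
        then show ?case using \<sigma>(2)[of y] by (auto split: split_indicator_asm simp: ennreal_eq_0_iff)
      qed
      then have "emeasure \<nu> (cell m x) = 0"
        by (subst (asm) AE_iff_measurable[OF _ refl]) (auto simp: s sets_eq_imp_space_eq[OF s])
      then show False using V[of m] V(2)[of m x] by simp
    qed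
    have "ennpowr (emeasure \<mu>s (cell m x)) (1 / p) \<noteq> 0" using pos p by (simp add: ennpowr_eq_0_iff)
    moreover have "cavg \<mu>s m f x * ennpowr (emeasure \<mu>s (cell m x)) (1 / p) < top"
      using measure_times_cavg_Hoelder[OF cs f p(1) conj, of m x] Nf unfolding Nf_def by (rule order.strict_trans1)
    ultimately have "cavg \<mu>s m f x < top" by (auto simp: ennreal_mult_less_top)
    moreover have "emeasure \<mu>s (cell m x) < top" using cs by (simp add: cell_finite_def)
    ultimately have "cavg \<nu> m F x * V m < top" unfolding Fcell by (simp add: ennreal_mult_less_top)
    then show ?thesis using V(1)[of m] by (auto simp: ennreal_mult_less_top ennreal_eq_0_iff not_le)
  qed
  \<comment> \<open>A term of the sum is non-zero only where generation \<open>m\<close> sets a new maximum, so that the factor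
    \<open>one\<close> below may be inserted.\<close>
  have core: "R m * (D m x * cavg \<nu> m G x) \<le> 4 * W * (D m x * \<Phi> m x * cavg \<nu> m (\<lambda>y. inverse (M y)) x)" for m x
  proof (cases "D m x = 0")
    case False
    define S where "S = cavg \<nu> m (\<lambda>x. ennreal (\<sigma> x)) x"
    define U where "U = cavg \<nu> m (\<lambda>x. ennreal (u x)) x"
    define I where "I = cavg \<nu> m (\<lambda>y. inverse (M y)) x"
    have one: "1 \<le> 4 * cavg \<nu> m F x * I"
      unfolding I_def M_def using False V(1)[of m] unfolding D_def
      by (intro cavg_inverse_maximal \<nu> finF) (auto simp: V(2))
    have "R m = ennpowr (ennreal (V m)) (1 - b)" using V(1)[of m] by (simp add: R_def ennpowr_ennreal_pos)
    then have RS: "R m * ennpowr S (1 - b) = ennpowr (emeasure \<mu>s (cell m x)) (1 - b)"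
      using b by (simp add: scell S_def ennpowr_mult mult.commute)
    have S: "S = ennpowr S b * ennpowr S (1 - b)" using ennpowr_add[of b "1 - b" S] b by simp
    have "R m * (cavg \<nu> m F x * cavg \<nu> m G x) = R m * ((cavg \<mu>s m f x * S) * (cavg \<mu>u m g x * U))"
      by (simp only: cavgF cavgG S_def U_def)
    also have "\<dots> = R m * ((cavg \<mu>s m f x * (ennpowr S b * ennpowr S (1 - b))) * (cavg \<mu>u m g x * U))"
      using S by simp
    also have "\<dots> = (U * ennpowr S b) * ((R m * ennpowr S (1 - b)) * cavg \<mu>s m f x * cavg \<mu>u m g x)"
      by (simp only: mult_ac)
    also have "\<dots> = (U * ennpowr S b) * \<Phi> m x" by (simp only: RS \<Phi>_def)
    also have "\<dots> \<le> W * \<Phi> m x"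
      unfolding U_def S_def by (intro mult_right_mono W) simp
    finally have FG: "R m * (cavg \<nu> m F x * cavg \<nu> m G x) \<le> W * \<Phi> m x" .
    have "R m * (D m x * cavg \<nu> m G x) * 1 \<le> R m * (D m x * cavg \<nu> m G x) * (4 * cavg \<nu> m F x * I)"
      using one by (rule mult_left_mono) simp
    also have "\<dots> = 4 * D m x * I * (R m * (cavg \<nu> m F x * cavg \<nu> m G x))" by (simp only: mult_ac)
    also have "\<dots> \<le> 4 * D m x * I * (W * \<Phi> m x)" using FG by (rule mult_left_mono) simp
    also have "\<dots> = 4 * W * (D m x * \<Phi> m x * I)" by (simp only: mult_ac)
    finally show ?thesis by (simp add: I_def)
  qed simp
  \<comment> \<open>Since the increments sum to at most \<open>M\<close>, the weights \<open>D m x / M x\<close> turn the sum into a supremum.\<close>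
  have pointwise: "(\<Sum>m. D m x * \<Phi> m x * inverse (M x))
      \<le> ennpowr Nf (1 - p / q) * (ennpowr (maximal \<mu>s f x) (p / q) * maximal \<mu>u g x)" for x
  proof -
    define T where "T = ennpowr Nf (1 - p / q) * (ennpowr (maximal \<mu>s f x) (p / q) * maximal \<mu>u g x)"
    have \<Phi>T: "\<Phi> m x \<le> T" for m
    proof -
      have "\<Phi> m x \<le> (ennpowr Nf (1 - p / q) * ennpowr (maximal \<mu>s f x) (p / q)) * maximal \<mu>u g x"
        unfolding \<Phi>_def Nf_def p(3)[symmetric]
        by (intro mult_mono fractional_cavg_le_maximal[OF cs f p(1,2)] cavg_le_maximal) auto
      then show ?thesis by (simp add: T_def mult.assoc)
    qed
    have "(\<Sum>m. D m x * \<Phi> m x * inverse (M x)) \<le> (\<Sum>m. D m x * T * inverse (M x))"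
      using \<Phi>T by (intro suminf_le mult_right_mono mult_left_mono) auto
    also have "\<dots> = (\<Sum>m. D m x) * T * inverse (M x)" by (simp only: ennreal_suminf_multc)
    also have "\<dots> \<le> M x * T * inverse (M x)" by (intro mult_right_mono sumD) auto
    also have "\<dots> = T * (M x / M x)" by (simp add: divide_ennreal_def mult_ac)
    also have "M x / M x \<le> 1"
      by (cases "M x = 0"; cases "M x = top") (auto simp: less_top)
    then have "T * (M x / M x) \<le> T * 1" by (rule mult_left_mono) simp
    finally show ?thesis by (simp add: T_def)
  qed
  have CR: "(\<Sum>m. if j \<le> m then R m else 0) \<le> C * R j" for j
    unfolding R_def by (rule C)
  define I where "I m = (\<integral>\<^sup>+x. D m x * \<Phi> m x * inverse (M x) \<partial>\<nu>)" for m
  have "(\<integral>\<^sup>+x. (\<Sum>m. R m * cavg \<nu> m F x) * G x \<partial>\<nu>) \<le> (\<integral>\<^sup>+x. C * (\<Sum>m. R m * D m x) * G x \<partial>\<nu>)"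
    unfolding D_def by (intro nn_integral_mono mult_right_mono suminf_le_increments CR) auto
  also have "\<dots> = (\<integral>\<^sup>+x. C * (\<Sum>m. R m * (D m x * G x)) \<partial>\<nu>)"
    by (intro nn_integral_cong) (simp add: mult.assoc flip: ennreal_suminf_multc)
  also have "\<dots> = C * (\<Sum>m. R m * (\<integral>\<^sup>+x. D m x * G x \<partial>\<nu>))"
    by (simp add: nn_integral_cmult nn_integral_suminf)
  finally have step1: "(\<integral>\<^sup>+x. (\<Sum>m. R m * cavg \<nu> m F x) * G x \<partial>\<nu>)
      \<le> C * (\<Sum>m. R m * (\<integral>\<^sup>+x. D m x * G x \<partial>\<nu>))" .
  have step2: "(\<Sum>m. R m * (\<integral>\<^sup>+x. D m x * G x \<partial>\<nu>)) \<le> (\<Sum>m. 4 * W * I m)"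
  proof (intro suminf_le)
    fix m
    have "R m * (\<integral>\<^sup>+x. D m x * G x \<partial>\<nu>) = R m * (\<integral>\<^sup>+x. D m x * cavg \<nu> m G x \<partial>\<nu>)"
      by (subst nn_integral_level_cavg[OF \<nu> levD]) simp_all
    also have "\<dots> = (\<integral>\<^sup>+x. R m * (D m x * cavg \<nu> m G x) \<partial>\<nu>)"
      by (rule nn_integral_cmult[symmetric]) measurable
    also have "\<dots> \<le> (\<integral>\<^sup>+x. 4 * W * (D m x * \<Phi> m x * cavg \<nu> m (\<lambda>y. inverse (M y)) x) \<partial>\<nu>)"
      by (intro nn_integral_mono core)
    also have "\<dots> = 4 * W * (\<integral>\<^sup>+x. D m x * \<Phi> m x * cavg \<nu> m (\<lambda>y. inverse (M y)) x \<partial>\<nu>)"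
      by (rule nn_integral_cmult) measurable
    also have "(\<integral>\<^sup>+x. D m x * \<Phi> m x * cavg \<nu> m (\<lambda>y. inverse (M y)) x \<partial>\<nu>)
        = I m"
      unfolding I_def
    proof (rule nn_integral_level_cavg[OF \<nu>, symmetric])
      show "level m (\<lambda>x. D m x * \<Phi> m x)"
      proof (rule levelI)
        fix x y assume xy: "c m x = c m y"
        show "D m x * \<Phi> m x = D m y * \<Phi> m y"
          unfolding level_cong[OF levD xy] level_cong[OF lev\<Phi> xy] ..
      qed
    qed measurable
    finally show "R m * (\<integral>\<^sup>+x. D m x * G x \<partial>\<nu>) \<le> 4 * W * I m" .
  qed auto
  have "(\<Sum>m. I m) = (\<integral>\<^sup>+x. (\<Sum>m. D m x * \<Phi> m x * inverse (M x)) \<partial>\<nu>)"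
    unfolding I_def by (rule nn_integral_suminf[symmetric]) measurable
  also have "\<dots>
      \<le> (\<integral>\<^sup>+x. ennpowr Nf (1 - p / q) * (ennpowr (maximal \<mu>s f x) (p / q) * maximal \<mu>u g x) \<partial>\<nu>)"
    by (intro nn_integral_mono pointwise)
  also have "\<dots> = ennpowr Nf (1 - p / q) * (\<integral>\<^sup>+x. ennpowr (maximal \<mu>s f x) (p / q) * maximal \<mu>u g x \<partial>\<nu>)"
    by (rule nn_integral_cmult) measurable
  finally have step3: "(\<Sum>m. I m) \<le> ennpowr Nf (1 - p / q) * (\<integral>\<^sup>+x. ennpowr (maximal \<mu>s f x) (p / q) * maximal \<mu>u g x \<partial>\<nu>)" .
  have "(\<integral>\<^sup>+x. ennpowr (maximal \<mu>s f x) (p / q) * maximal \<mu>u g x \<partial>\<nu>)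
     = (\<integral>\<^sup>+x. (ennpowr (maximal \<mu>s f x) (p / q) * ennpowr (\<sigma> x) (1 / q)) * (maximal \<mu>u g x * ennpowr (u x) (1 / q')) \<partial>\<nu>)"
  proof (intro nn_integral_cong)
    fix x
    have "ennpowr (\<sigma> x) (1 / q) * ennpowr (u x) (1 / q') = 1"
      using dual[of x] u(2)[of x] \<sigma>(2)[of x] by (simp add: ennpowr_ennreal_pos flip: ennreal_mult)
    then have one: "ennpowr (maximal \<mu>s f x) (p / q) * maximal \<mu>u g x
      = (ennpowr (maximal \<mu>s f x) (p / q) * maximal \<mu>u g x) * (ennpowr (\<sigma> x) (1 / q) * ennpowr (u x) (1 / q'))"
      by simp
    show "ennpowr (maximal \<mu>s f x) (p / q) * maximal \<mu>u g x
      = (ennpowr (maximal \<mu>s f x) (p / q) * ennpowr (\<sigma> x) (1 / q)) * (maximal \<mu>u g x * ennpowr (u x) (1 / q'))"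
      by (subst one) (simp only: mult_ac)
  qed
  also have "\<dots> \<le> ennpowr (\<integral>\<^sup>+x. ennpowr (ennpowr (maximal \<mu>s f x) (p / q) * ennpowr (\<sigma> x) (1 / q)) q \<partial>\<nu>) (1 / q)
      * ennpowr (\<integral>\<^sup>+x. ennpowr (maximal \<mu>u g x * ennpowr (u x) (1 / q')) q' \<partial>\<nu>) (1 / q')"
    by (rule nn_integral_Hoelder[OF q]) measurable
  also have "(\<integral>\<^sup>+x. ennpowr (ennpowr (maximal \<mu>s f x) (p / q) * ennpowr (\<sigma> x) (1 / q)) q \<partial>\<nu>)
      = (\<integral>\<^sup>+x. ennpowr (maximal \<mu>s f x) p \<partial>\<mu>s)"
    using p q by (subst int_s) (auto simp: ennpowr_mult ennpowr_ennpowr)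
  also have "(\<integral>\<^sup>+x. ennpowr (maximal \<mu>u g x * ennpowr (u x) (1 / q')) q' \<partial>\<nu>)
      = (\<integral>\<^sup>+x. ennpowr (maximal \<mu>u g x) q' \<partial>\<mu>u)"
    using q by (subst int_u) (auto simp: ennpowr_mult ennpowr_ennpowr)
  finally have step4: "(\<integral>\<^sup>+x. ennpowr (maximal \<mu>s f x) (p / q) * maximal \<mu>u g x \<partial>\<nu>)
      \<le> ennpowr (\<integral>\<^sup>+x. ennpowr (maximal \<mu>s f x) p \<partial>\<mu>s) (1 / q)
        * ennpowr (\<integral>\<^sup>+x. ennpowr (maximal \<mu>u g x) q' \<partial>\<mu>u) (1 / q')" .
  define Ng where "Ng = ennpowr (\<integral>\<^sup>+x. ennpowr (g x) q' \<partial>\<mu>u) (1 / q')"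
  define K where "K = ennreal ((2 powr p * p / (p - 1)) powr (1 / q))"
  define L where "L = ennreal ((2 powr q' * q' / (q' - 1)) powr (1 / q'))"
  have "ennpowr (\<integral>\<^sup>+x. ennpowr (maximal \<mu>s f x) p \<partial>\<mu>s) (1 / q)
      \<le> ennpowr (ennreal (2 powr p * p / (p - 1)) * (\<integral>\<^sup>+x. ennpowr (f x) p \<partial>\<mu>s)) (1 / q)"
    using q by (intro ennpowr_mono maximal_strong_type cs p) auto
  also have "\<dots> = K * ennpowr Nf (p / q)"
    using p q by (simp add: ennpowr_mult ennpowr_ennpowr ennpowr_ennreal Nf_def K_def)
  finally have Ms: "ennpowr (\<integral>\<^sup>+x. ennpowr (maximal \<mu>s f x) p \<partial>\<mu>s) (1 / q) \<le> K * ennpowr Nf (p / q)" .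
  have "ennpowr (\<integral>\<^sup>+x. ennpowr (maximal \<mu>u g x) q' \<partial>\<mu>u) (1 / q')
      \<le> ennpowr (ennreal (2 powr q' * q' / (q' - 1)) * (\<integral>\<^sup>+x. ennpowr (g x) q' \<partial>\<mu>u)) (1 / q')"
    using q by (intro ennpowr_mono maximal_strong_type cu) auto
  also have "\<dots> = L * Ng"
    using q by (simp add: ennpowr_mult ennpowr_ennreal L_def Ng_def)
  finally have Mu: "ennpowr (\<integral>\<^sup>+x. ennpowr (maximal \<mu>u g x) q' \<partial>\<mu>u) (1 / q') \<le> L * Ng" .
  have "0 < p / q" "0 < 1 - p / q" using p by auto
  then have Nf: "ennpowr Nf (1 - p / q) * ennpowr Nf (p / q) = Nf"
    using ennpowr_add[of "1 - p / q" "p / q" Nf] by simp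
  have KL: "ennreal ((2 powr p * p / (p - 1)) powr (1 / q) * (2 powr q' * q' / (q' - 1)) powr (1 / q')) = K * L"
    unfolding K_def L_def by (rule ennreal_mult) auto
  have "(\<integral>\<^sup>+x. (\<Sum>m. R m * cavg \<nu> m F x) * G x \<partial>\<nu>) \<le> C * (\<Sum>m. 4 * W * I m)"
    by (rule order_trans[OF step1 mult_left_mono[OF step2]]) simp
  also have "\<dots> = C * (4 * W) * (\<Sum>m. I m)" by (simp add: mult.assoc)
  also have "\<dots> \<le> C * (4 * W) * (ennpowr Nf (1 - p / q) * ((K * ennpowr Nf (p / q)) * (L * Ng)))"
    by (intro mult_left_mono order_trans[OF step3] order_trans[OF step4] mult_mono Ms Mu) auto
  also have "\<dots> = 4 * C * W * (K * L) * (ennpowr Nf (1 - p / q) * ennpowr Nf (p / q)) * Ng"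
    by (simp only: mult_ac)
  also have "\<dots> = 4 * C * W * (K * L) * Nf * Ng" by (simp only: Nf)
  finally show ?thesis
    unfolding KL by (simp add: R_def F_def[abs_def] G_def[abs_def] Nf_def Ng_def int_u int_s)
qed

end

section \<open>Translated dyadic grids\<close>

text \<open>The dyadic grid with cells of side \<open>L / 2 ^ m\<close>, translated by a third of \<open>L\<close> in the coordinates
  that belong to \<open>S\<close>. The same translation for all generations keeps the grid nested, and
  \<open>2 ^ m / 3\<close> is never closer than \<open>1 / 3\<close> to an integer, so that the translation stays visible at
  every scale.\<close>

definition grid_index :: "'n set \<Rightarrow> real \<Rightarrow> nat \<Rightarrow> real ^ 'n \<Rightarrow> int ^ 'n" where
  "grid_index S L m x = (\<chi> i. \<lfloor>2 ^ m * (x $ i / L - (if i \<in> S then 1 / 3 else 0))\<rfloor>)"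

definition grid_code :: "'n::finite set \<Rightarrow> real \<Rightarrow> nat \<Rightarrow> real ^ 'n \<Rightarrow> nat" where
  "grid_code S L m x = to_nat (grid_index S L m x)"

definition grid_corner :: "'n set \<Rightarrow> real \<Rightarrow> nat \<Rightarrow> real ^ 'n \<Rightarrow> real ^ 'n" where
  "grid_corner S L m x = (\<chi> i. L * (of_int (grid_index S L m x $ i) / 2 ^ m + (if i \<in> S then 1 / 3 else 0)))"

lemma grid_code_eq_iff: "grid_code S L m x = grid_code S L m y \<longleftrightarrow> grid_index S L m x = grid_index S L m y"
  by (simp add: grid_code_def)

lemma floor_eq_interval:
  fixes X :: real
  assumes "0 < L"
  shows "\<lfloor>2 ^ m * (X / L - t)\<rfloor> = z \<longleftrightarrow> L * (of_int z / 2 ^ m + t) \<le> X \<and> X < L * (of_int z / 2 ^ m + t) + L / 2 ^ m"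
proof -
  have "\<lfloor>2 ^ m * (X / L - t)\<rfloor> = z \<longleftrightarrow> of_int z \<le> 2 ^ m * (X / L - t) \<and> 2 ^ m * (X / L - t) < of_int z + 1"
    by (simp add: floor_eq_iff)
  also have "of_int z \<le> 2 ^ m * (X / L - t) \<longleftrightarrow> L * (of_int z / 2 ^ m + t) \<le> X"
    using assms by (simp add: field_simps)
  also have "2 ^ m * (X / L - t) < of_int z + 1 \<longleftrightarrow> X < L * (of_int z / 2 ^ m + t) + L / 2 ^ m"
    using assms by (simp add: field_simps)
  finally show ?thesis .
qed

lemma grid_index_eq_iff:
  assumes "0 < L"
  shows "grid_index S L m y = grid_index S L m x \<longleftrightarrow>
    (\<forall>i. grid_corner S L m x $ i \<le> y $ i \<and> y $ i < grid_corner S L m x $ i + L / 2 ^ m)"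
  unfolding vec_eq_iff grid_corner_def vec_lambda_beta
  by (intro all_cong1) (simp only: grid_index_def vec_lambda_beta floor_eq_interval[OF assms])

lemma grid_refine:
  assumes "grid_index S L (Suc m) x = grid_index S L (Suc m) y"
  shows "grid_index S L m x = grid_index S L m y"
proof -
  have half: "\<lfloor>2 ^ m * X\<rfloor> = \<lfloor>2 ^ Suc m * X\<rfloor> div 2" for X :: real
    using floor_divide_real_eq_div[of 2 "2 ^ Suc m * X"] by simp
  show ?thesis
    using assms by (simp only: grid_index_def vec_eq_iff vec_lambda_beta half simp_thms)
qed

lemma half_open_cube_borel:
  fixes a :: "real ^ 'n"
  shows "{y. \<forall>i. a $ i \<le> y $ i \<and> y $ i < a $ i + l} \<in> sets borel"
proof -
  have "{y::real ^ 'n. a $ i \<le> y $ i \<and> y $ i < a $ i + l} \<in> sets borel" for i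
  proof -
    have "{y::real ^ 'n. a $ i \<le> y $ i \<and> y $ i < a $ i + l} = {y. a $ i \<le> y $ i} \<inter> {y. y $ i < a $ i + l}"
      by auto
    moreover have "closed {y::real ^ 'n. a $ i \<le> y $ i}" by (rule closed_halfspace_component_ge_cart)
    moreover have "open {y::real ^ 'n. y $ i < a $ i + l}" by (rule open_halfspace_component_lt_cart)
    ultimately show ?thesis by simp
  qed
  moreover have "{y. \<forall>i. a $ i \<le> y $ i \<and> y $ i < a $ i + l} = (\<Inter>i. {y. a $ i \<le> y $ i \<and> y $ i < a $ i + l})"
    by auto
  ultimately show ?thesis by auto
qed

lemma emeasure_cube:
  fixes a :: "real ^ 'n"
  assumes "0 \<le> l"
  shows "emeasure lborel (cbox a (a + (\<chi> i. l))) = ennreal (l ^ CARD('n))"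
    and "emeasure lborel (box a (a + (\<chi> i. l))) = ennreal (l ^ CARD('n))"
proof -
  have in_Basis: "(\<chi> i. l) \<bullet> e = l" if "e \<in> Basis" for e :: "real ^ 'n"
    using that by (auto simp: Basis_vec_def inner_axis)
  have "(\<Prod>e\<in>Basis. ((a + (\<chi> i. l)) - a) \<bullet> e) = (\<Prod>e\<in>(Basis :: (real ^ 'n) set). l)"
    by (intro prod.cong) (auto simp: in_Basis)
  also have "\<dots> = l ^ CARD('n)" by simp
  finally have P: "(\<Prod>e\<in>Basis. ((a + (\<chi> i. l)) - a) \<bullet> e) = l ^ CARD('n)" .
  have le: "a \<bullet> e \<le> (a + (\<chi> i. l)) \<bullet> e" if "e \<in> Basis" for e
    using assms in_Basis[OF that] by (simp add: inner_add_left)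
  show "emeasure lborel (cbox a (a + (\<chi> i. l))) = ennreal (l ^ CARD('n))"
    using emeasure_lborel_cbox[of a "a + (\<chi> i. l)"] le unfolding P by simp
  show "emeasure lborel (box a (a + (\<chi> i. l))) = ennreal (l ^ CARD('n))"
    using emeasure_lborel_box[of a "a + (\<chi> i. l)"] le unfolding P by simp
qed

lemma emeasure_half_open_cube:
  fixes a :: "real ^ 'n"
  assumes "0 \<le> l"
  shows "emeasure lborel {y. \<forall>i. a $ i \<le> y $ i \<and> y $ i < a $ i + l} = ennreal (l ^ CARD('n))"
proof (rule antisym)
  have "{y. \<forall>i. a $ i \<le> y $ i \<and> y $ i < a $ i + l} \<subseteq> cbox a (a + (\<chi> i. l))"
    by (auto simp: mem_box_cart less_imp_le)
  then show "emeasure lborel {y. \<forall>i. a $ i \<le> y $ i \<and> y $ i < a $ i + l} \<le> ennreal (l ^ CARD('n))"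
    unfolding emeasure_cube(1)[OF assms, of a, symmetric] by (rule emeasure_mono) simp
  have "box a (a + (\<chi> i. l)) \<subseteq> {y. \<forall>i. a $ i \<le> y $ i \<and> y $ i < a $ i + l}"
    by (auto simp: mem_box_cart less_imp_le)
  then show "ennreal (l ^ CARD('n)) \<le> emeasure lborel {y. \<forall>i. a $ i \<le> y $ i \<and> y $ i < a $ i + l}"
    unfolding emeasure_cube(2)[OF assms, of a, symmetric]
    by (rule emeasure_mono) (simp add: half_open_cube_borel)
qed

lemma nested_partition_grid:
  fixes S :: "'n::finite set"
  assumes L: "0 < L"
  shows "nested_partition (grid_code S L)"
proof
  fix m
  have "grid_code S L m -` {k} \<in> sets borel" for k
  proof (cases "\<exists>x. grid_code S L m x = k")
    case True
    then obtain x where "k = grid_code S L m x" by auto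
    then have "grid_code S L m -` {k} = {y. \<forall>i. grid_corner S L m x $ i \<le> y $ i \<and> y $ i < grid_corner S L m x $ i + L / 2 ^ m}"
      by (auto simp: grid_code_eq_iff grid_index_eq_iff[OF L])
    then show ?thesis by (simp only: half_open_cube_borel)
  next
    case False
    then have "grid_code S L m -` {k} = {}" by auto
    then show ?thesis by simp
  qed
  then show "grid_code S L m \<in> borel \<rightarrow>\<^sub>M count_space UNIV"
    by (simp add: measurable_count_space_eq2_countable)
next
  fix m x y
  show "grid_code S L (Suc m) x = grid_code S L (Suc m) y \<Longrightarrow> grid_code S L m x = grid_code S L m y"
    unfolding grid_code_eq_iff by (rule grid_refine)
qed

lemma grid_cell:
  assumes "0 < L"
  shows "nested_partition.cell (grid_code S L) m x
    = {y. \<forall>i. grid_corner S L m x $ i \<le> y $ i \<and> y $ i < grid_corner S L m x $ i + L / 2 ^ m}"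
  unfolding nested_partition.cell_def[OF nested_partition_grid[OF assms]]
  by (simp add: grid_code_eq_iff grid_index_eq_iff[OF assms])

lemma emeasure_grid_cell:
  fixes S :: "'n::finite set"
  assumes "0 < L"
  shows "emeasure lborel (nested_partition.cell (grid_code S L) m x) = ennreal ((L / 2 ^ m) ^ CARD('n))"
  unfolding grid_cell[OF assms] using assms by (intro emeasure_half_open_cube) simp

lemma cell_finite_grid:
  assumes "0 < L"
  shows "nested_partition.cell_finite (grid_code S L) lborel"
  unfolding nested_partition.cell_finite_def[OF nested_partition_grid[OF assms]]
  by (simp add: emeasure_grid_cell[OF assms])

text \<open>The breakpoints of the two grids on the line are at distance at least \<open>1 / 3\<close> from each other, since
  \<open>2 ^ m\<close> is not divisible by three. A shorter interval cannot contain a breakpoint of both.\<close>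

lemma floor_eq_or_shifted_floor_eq:
  fixes X Y :: real
  assumes "\<bar>X - Y\<bar> < 1 / 3"
  shows "\<lfloor>X\<rfloor> = \<lfloor>Y\<rfloor> \<or> \<lfloor>X - 2 ^ m / 3\<rfloor> = \<lfloor>Y - 2 ^ m / 3\<rfloor>"
proof (rule ccontr)
  assume neg: "\<not> ?thesis"
  have sep: "\<exists>k::int. min A B < of_int k \<and> of_int k \<le> max A B" if "\<lfloor>A\<rfloor> \<noteq> \<lfloor>B\<rfloor>" for A B :: real
    using that
  proof (cases "A \<le> B")
    case True
    with that have "\<lfloor>A\<rfloor> < \<lfloor>B\<rfloor>" using floor_mono[of A B] by linarith
    then have "A < of_int \<lfloor>B\<rfloor>" by (simp add: floor_less_iff)
    with True show ?thesis by (intro exI[of _ "\<lfloor>B\<rfloor>"]) auto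
  next
    case False
    with that have "\<lfloor>B\<rfloor> < \<lfloor>A\<rfloor>" using floor_mono[of B A] by linarith
    then have "B < of_int \<lfloor>A\<rfloor>" by (simp add: floor_less_iff)
    with False show ?thesis by (intro exI[of _ "\<lfloor>A\<rfloor>"]) auto
  qed
  obtain k :: int where k: "min X Y < of_int k" "of_int k \<le> max X Y" using neg sep by blast
  obtain l :: int where l: "min (X - 2 ^ m / 3) (Y - 2 ^ m / 3) < of_int l" "of_int l \<le> max (X - 2 ^ m / 3) (Y - 2 ^ m / 3)"
    using neg sep by blast
  have "\<bar>of_int k - of_int l - 2 ^ m / 3\<bar> < (1 / 3 :: real)"
    using k l assms by (auto simp: min_def max_def abs_if split: if_splits)
  then have "\<bar>of_int (3 * (k - l) - 2 ^ m)\<bar> < (1 :: real)" by (simp add: abs_if split: if_splits)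
  then have "\<bar>3 * (k - l) - 2 ^ m\<bar> < 1" by linarith
  then have "3 * (k - l) = 2 ^ m" by simp
  then have "(3::int) dvd 2 ^ m" by (metis dvd_triv_left)
  moreover have "coprime (3::int) (2 ^ m)" by (simp add: coprime_power_right_iff)
  ultimately have "is_unit (3::int)" by (metis coprime_absorb_left)
  then show False by simp
qed

text \<open>The translation is made in exactly those coordinates in which the untranslated grid separates the
  two points; there the translated one cannot separate them.\<close>

lemma exists_grid_cell:
  fixes x y :: "real ^ 'n"
  assumes L: "0 < L" and d: "norm (x - y) < L / 2 ^ m / 3"
  shows "\<exists>S. y \<in> nested_partition.cell (grid_code S L) m x"
proof -
  define S where "S = {i. \<lfloor>2 ^ m * (x $ i / L)\<rfloor> \<noteq> \<lfloor>2 ^ m * (y $ i / L)\<rfloor>}"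
  have "\<lfloor>2 ^ m * (y $ i / L - (if i \<in> S then 1 / 3 else 0))\<rfloor>
      = \<lfloor>2 ^ m * (x $ i / L - (if i \<in> S then 1 / 3 else 0))\<rfloor>" for i
  proof -
    have "\<bar>x $ i - y $ i\<bar> < L / 2 ^ m / 3"
      using component_le_norm_cart[of "x - y" i] d by simp
    then have "\<bar>2 ^ m * (x $ i / L) - 2 ^ m * (y $ i / L)\<bar> < 1 / 3"
      using L by (simp add: field_simps abs_if split: if_splits)
    from floor_eq_or_shifted_floor_eq[OF this, of m] show ?thesis
      by (auto simp: S_def right_diff_distrib)
  qed
  then have "grid_index S L m y = grid_index S L m x" by (simp add: grid_index_def)
  then show ?thesis
    by (auto simp: nested_partition.cell_def[OF nested_partition_grid[OF L]] grid_code_eq_iff)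
qed

text \<open>The finest generation whose cells are still longer than \<open>3 * d\<close>; those of the next one are half as
  long, which gives the factor six.\<close>

lemma exists_dyadic_scale:
  fixes d L :: real
  assumes "0 < d" "d < L / 3"
  shows "\<exists>m. d < L / 2 ^ m / 3 \<and> L / 2 ^ m \<le> 6 * d"
proof -
  define P where "P m \<longleftrightarrow> L / 2 ^ m / 3 \<le> d" for m :: nat
  have L: "0 < L" using assms by simp
  obtain N :: nat where "L / (3 * d) < 2 ^ N" using real_arch_pow[of 2] by force
  then have "P N" using assms by (simp add: P_def field_simps)
  then have PL: "P (LEAST m. P m)" by (rule LeastI)
  have "\<not> P 0" using assms by (simp add: P_def)
  then obtain m where m: "(LEAST m. P m) = Suc m" using PL by (metis not0_implies_Suc)
  have "\<not> P m" using not_less_Least[of m P] m by simp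
  moreover have "P (Suc m)" using PL m by simp
  ultimately show ?thesis by (intro exI[of _ m]) (auto simp: P_def field_simps)
qed

lemma geometric_tail:
  fixes x :: real
  assumes "0 < x" "x < 1" "0 \<le> c"
  shows "(\<Sum>m. if j \<le> m then ennreal (c * x ^ m) else 0) = ennreal (1 / (1 - x)) * ennreal (c * x ^ j)"
proof -
  have "(\<lambda>i. c * x ^ j * x ^ i) sums (c * x ^ j * (1 / (1 - x)))"
    using assms by (intro sums_mult geometric_sums) auto
  then have "(\<lambda>i. if j \<le> i + j then c * x ^ (i + j) else 0) sums (c * x ^ j * (1 / (1 - x)))"
    by (simp add: power_add mult_ac)
  then have "(\<lambda>m. if j \<le> m then c * x ^ m else 0) sums (c * x ^ j * (1 / (1 - x)) + (\<Sum>m<j. if j \<le> m then c * x ^ m else 0))"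
    by (subst (asm) sums_iff_shift)
  then have "(\<lambda>m. if j \<le> m then c * x ^ m else 0) sums (c * x ^ j * (1 / (1 - x)))" by simp
  then have "(\<Sum>m. ennreal (if j \<le> m then c * x ^ m else 0)) = ennreal (c * x ^ j * (1 / (1 - x)))"
    using assms by (intro suminf_ennreal_eq) auto
  moreover have "ennreal (if j \<le> m then c * x ^ m else 0) = (if j \<le> m then ennreal (c * x ^ m) else 0)" for m
    by simp
  ultimately show ?thesis using assms by (simp add: mult.commute flip: ennreal_mult)
qed

section \<open>The Riesz potential of a non-negative function\<close>

lemma measurable_riesz_kernel [measurable]: "riesz_kernel \<alpha> \<in> borel_measurable borel"
  unfolding riesz_kernel_def[abs_def] by measurable

lemma riesz_kernel_nonneg: "0 \<le> riesz_kernel \<alpha> z"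
  by (simp add: riesz_kernel_def)

text \<open>For \<open>y \<noteq> x\<close> a single summand suffices: the cell of a generation with side comparable to the
  distance of \<open>x\<close> and \<open>y\<close>, in a grid that does not separate the two points. The truncation is needed
  because a nested partition has a coarsest generation.\<close>

lemma truncated_riesz_le_grid_sum:
  fixes F :: "real ^ 'n \<Rightarrow> ennreal"
  assumes \<alpha>: "0 < \<alpha>" "\<alpha> < real CARD('n)" and L: "0 < L" and F [measurable]: "F \<in> borel_measurable borel"
  defines "V \<equiv> \<lambda>m. (L / 2 ^ m) ^ CARD('n)"
  shows "(\<integral>\<^sup>+y. ennreal (riesz_kernel \<alpha> (x - y)) * F y * indicator {y. norm (x - y) < L / 3} y \<partial>lborel)
    \<le> ennreal (6 powr (real CARD('n) - \<alpha>)) * (\<Sum>S\<in>UNIV. \<Sum>m. ennreal (V m powr (\<alpha> / real CARD('n)))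
          * nested_partition.cavg (grid_code S L) lborel m F x)"
proof -
  define n where "n = real CARD('n)"
  define k where "k = ennreal (6 powr (n - \<alpha>))"
  define r where "r m = ennreal ((L / 2 ^ m) powr (\<alpha> - n))" for m :: nat
  define cl where "cl S m = nested_partition.cell (grid_code S L) m x" for S :: "'n set" and m
  have clm [measurable]: "cl S m \<in> sets borel" for S m
    unfolding cl_def by (rule nested_partition.cell_measurable[OF nested_partition_grid[OF L]])
  have n: "0 < n" by (simp add: n_def)
  have coeff: "ennreal (V m powr (\<alpha> / real CARD('n))) * nested_partition.cavg (grid_code S L) lborel m F x
      = r m * (\<integral>\<^sup>+y. F y * indicator (cl S m) y \<partial>lborel)" for S m
  proof -
    have V: "V m = (L / 2 ^ m) powr n" using L by (simp add: V_def n_def powr_realpow)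
    have Vp: "0 < V m" using L by (simp add: V_def)
    have "ennreal (V m powr (\<alpha> / real CARD('n))) * nested_partition.cavg (grid_code S L) lborel m F x
        = ennreal (V m powr (\<alpha> / n)) * inverse (ennreal (V m)) * (\<integral>\<^sup>+y. F y * indicator (cl S m) y \<partial>lborel)"
      unfolding nested_partition.cavg_def[OF nested_partition_grid[OF L]] emeasure_grid_cell[OF L] cl_def n_def
      by (simp add: divide_ennreal_def V_def mult_ac)
    also have "ennreal (V m powr (\<alpha> / n)) * inverse (ennreal (V m)) = ennreal (V m powr (\<alpha> / n) / V m)"
      using Vp by (simp add: inverse_ennreal divide_inverse flip: ennreal_mult)
    also have "V m powr (\<alpha> / n) / V m = (L / 2 ^ m) powr (\<alpha> - n)"
      unfolding V using n by (simp add: powr_powr powr_diff)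
    finally show ?thesis by (simp add: r_def)
  qed
  have pt: "ennreal (riesz_kernel \<alpha> (x - y)) * F y * indicator {y. norm (x - y) < L / 3} y
      \<le> k * (\<Sum>S\<in>UNIV. \<Sum>m. r m * (F y * indicator (cl S m) y))" for y
  proof (cases "x \<noteq> y \<and> norm (x - y) < L / 3")
    case True
    then obtain m where m: "norm (x - y) < L / 2 ^ m / 3" "L / 2 ^ m \<le> 6 * norm (x - y)"
      using exists_dyadic_scale[of "norm (x - y)" L] by auto
    obtain S where S: "y \<in> cl S m" using exists_grid_cell[OF L m(1)] by (auto simp: cl_def)
    have "riesz_kernel \<alpha> (x - y) = norm (x - y) powr (\<alpha> - n)"
      using powr_minus_divide[of "norm (x - y)" "n - \<alpha>"] by (simp add: riesz_kernel_def n_def)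
    also have "\<dots> = 6 powr (n - \<alpha>) * (6 * norm (x - y)) powr (\<alpha> - n)"
      using True powr_add[of 6 "n - \<alpha>" "\<alpha> - n"] by (simp add: powr_mult)
    also have "\<dots> \<le> 6 powr (n - \<alpha>) * (L / 2 ^ m) powr (\<alpha> - n)"
      using m(2) L \<alpha> by (intro mult_left_mono powr_mono2') (auto simp: n_def)
    finally have "ennreal (riesz_kernel \<alpha> (x - y)) \<le> k * r m"
      by (simp add: k_def r_def flip: ennreal_mult)
    then have "ennreal (riesz_kernel \<alpha> (x - y)) * F y * indicator {y. norm (x - y) < L / 3} y \<le> k * r m * F y"
      using True by (simp add: mult_right_mono)
    also have "\<dots> = k * (r m * (F y * indicator (cl S m) y))" using S by (simp add: mult.assoc)
    also have "\<dots> \<le> k * (\<Sum>m. r m * (F y * indicator (cl S m) y))"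
      using sum_le_suminf[of "\<lambda>m. r m * (F y * indicator (cl S m) y)" "{m}"] by (intro mult_left_mono) auto
    also have "\<dots> \<le> k * (\<Sum>S\<in>UNIV. \<Sum>m. r m * (F y * indicator (cl S m) y))"
      by (intro mult_left_mono member_le_sum) auto
    finally show ?thesis .
  qed (auto simp: riesz_kernel_def)
  have "(\<integral>\<^sup>+y. ennreal (riesz_kernel \<alpha> (x - y)) * F y * indicator {y. norm (x - y) < L / 3} y \<partial>lborel)
     \<le> (\<integral>\<^sup>+y. k * (\<Sum>S\<in>UNIV. \<Sum>m. r m * (F y * indicator (cl S m) y)) \<partial>lborel)"
    by (intro nn_integral_mono pt)
  also have "\<dots> = k * (\<Sum>S\<in>UNIV. \<Sum>m. r m * (\<integral>\<^sup>+y. F y * indicator (cl S m) y \<partial>lborel))"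
    by (simp add: nn_integral_cmult nn_integral_sum nn_integral_suminf)
  finally show ?thesis unfolding coeff k_def n_def .
qed

lemma nn_integral_set_pos:
  assumes [measurable]: "A \<in> sets M" "h \<in> borel_measurable M"
    and "0 < emeasure M A" "\<And>x. x \<in> A \<Longrightarrow> 0 < h x"
  shows "0 < (\<integral>\<^sup>+x\<in>A. h x \<partial>M)"
proof (rule ccontr)
  assume "\<not> 0 < (\<integral>\<^sup>+x\<in>A. h x \<partial>M)"
  then have "AE x in M. h x * indicator A x = 0"
    by (subst nn_integral_0_iff_AE[symmetric]) auto
  then have "AE x in M. x \<notin> A"
  proof eventually_elim
    case (elim x)
    then show ?case using assms(4)[of x] by (auto split: split_indicator_asm)
  qed
  then have "A \<in> null_sets M" by (subst AE_iff_null_sets) auto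
  then show False using assms(3) by (auto simp: null_sets_def)
qed

text \<open>A half-open cell is contained in its closure, which is a cube of the same measure.\<close>

lemma cavg_le_Apq_const:
  fixes w :: "real ^ 'n \<Rightarrow> real"
  assumes L: "0 < L" and w [measurable]: "w \<in> borel_measurable borel" "\<And>x. 0 < w x"
    and p: "0 < q" "0 < conj_exponent p"
  shows "nested_partition.cavg (grid_code S L) lborel m (\<lambda>x. ennreal (w x powr q)) x
     * ennpowr (nested_partition.cavg (grid_code S L) lborel m (\<lambda>x. ennreal (w x powr - conj_exponent p)) x) (q / conj_exponent p)
     \<le> Apq_const p q w"
proof -
  define l where "l = L / 2 ^ m"
  define a where "a = grid_corner S L m x"
  define Q where "Q = cbox a (a + (\<chi> i. l))"
  have l: "0 < l" using L by (simp add: l_def)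
  have sub: "nested_partition.cell (grid_code S L) m x \<subseteq> Q"
    unfolding grid_cell[OF L] by (auto simp: Q_def a_def l_def mem_box_cart less_imp_le)
  have le: "nested_partition.cavg (grid_code S L) lborel m h x \<le> avg Q h" for h :: "real ^ 'n \<Rightarrow> ennreal"
  proof -
    have "emeasure lebesgue Q = emeasure lborel (nested_partition.cell (grid_code S L) m x)"
      using emeasure_cube(1)[of l a] l by (simp add: emeasure_grid_cell[OF L] Q_def l_def)
    moreover have "(\<integral>\<^sup>+y\<in>nested_partition.cell (grid_code S L) m x. h y \<partial>lborel) \<le> (\<integral>\<^sup>+y\<in>Q. h y \<partial>lebesgue)"
      unfolding nn_integral_completion using sub by (intro nn_integral_mono) (auto split: split_indicator)
    ultimately show ?thesis
      unfolding nested_partition.cavg_def[OF nested_partition_grid[OF L]] avg_def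
      by (simp add: divide_right_mono_ennreal)
  qed
  have "nested_partition.cavg (grid_code S L) lborel m (\<lambda>x. ennreal (w x powr q)) x
     * ennpowr (nested_partition.cavg (grid_code S L) lborel m (\<lambda>x. ennreal (w x powr - conj_exponent p)) x) (q / conj_exponent p)
     \<le> avg Q (\<lambda>x. ennreal (w x powr q)) * ennpowr (avg Q (\<lambda>x. ennreal (w x powr - conj_exponent p))) (q / conj_exponent p)"
    using p by (intro mult_mono ennpowr_mono le) auto
  also have "\<dots> = avg Q (\<lambda>x. ennpowr (ennreal (w x)) q)
      * ennpowr (avg Q (\<lambda>x. ennpowr (ennreal (w x)) (- conj_exponent p))) (q / conj_exponent p)"
    using w(2) by (simp add: ennpowr_ennreal_pos)
  also have "\<dots> \<le> Apq_const p q w"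
    unfolding Apq_const_def by (rule SUP_upper) (use l in \<open>auto simp: cubes_def Q_def\<close>)
  finally show ?thesis .
qed

text \<open>The factors are, in this order: the comparison of the kernel with a power of the side of a cell, the
  number of grids, the constant of the bilinear estimate with the sum of a geometric series, and powers
  of the constants of the two maximal inequalities.\<close>

definition riesz_const :: "real \<Rightarrow> real \<Rightarrow> real \<Rightarrow> real \<Rightarrow> real \<Rightarrow> real" where
  "riesz_const n \<alpha> p q q' = 6 powr (n - \<alpha>) * 2 powr n * (4 * (1 / (1 - 2 powr - \<alpha>)) *
     ((2 powr p * p / (p - 1)) powr (1 / q) * (2 powr q' * q' / (q' - 1)) powr (1 / q')))"

text \<open>The bilinear estimate on each of the grids of size \<open>L\<close>, summed over the grids. Its constant does not
  depend on \<open>L\<close>, which can therefore tend to infinity.\<close>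

theorem riesz_bilinear_bound:
  fixes w :: "real ^ 'n \<Rightarrow> real" and F g :: "real ^ 'n \<Rightarrow> ennreal"
  assumes \<alpha>: "0 < \<alpha>" "\<alpha> < real CARD('n)" and p: "1 < p" "p < q"
    and pq: "1 / p - 1 / q = \<alpha> / real CARD('n)" "q / conj_exponent p = 1 - \<alpha> / real CARD('n)"
    and w [measurable]: "w \<in> borel_measurable borel" "\<And>x. 0 < w x" and A: "Apq_const p q w < top"
    and F [measurable]: "F \<in> borel_measurable borel" and g [measurable]: "g \<in> borel_measurable borel"
    and fin: "(\<integral>\<^sup>+x. ennpowr (w x * F x) p \<partial>lborel) < top"
  shows "(\<integral>\<^sup>+x. (\<integral>\<^sup>+y. ennreal (riesz_kernel \<alpha> (x - y)) * F y \<partial>lborel) * (g x * ennreal (w x powr q)) \<partial>lborel)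
    \<le> ennreal (riesz_const (real CARD('n)) \<alpha> p q (conj_exponent q)) * Apq_const p q w
        * ennpowr (\<integral>\<^sup>+x. ennpowr (w x * F x) p \<partial>lborel) (1 / p)
        * ennpowr (\<integral>\<^sup>+x. ennpowr (g x) (conj_exponent q) * ennreal (w x powr q) \<partial>lborel) (1 / conj_exponent q)"
    (is "_ \<le> ?rhs")
proof -
  define n where "n = real CARD('n)"
  define b where "b = 1 - \<alpha> / n"
  define p' where "p' = conj_exponent p"
  define q' where "q' = conj_exponent q"
  define W where "W = Apq_const p q w"
  define Nf where "Nf = ennpowr (\<integral>\<^sup>+x. ennpowr (w x * F x) p \<partial>lborel) (1 / p)"
  define Ng where "Ng = ennpowr (\<integral>\<^sup>+x. ennpowr (g x) q' * ennreal (w x powr q) \<partial>lborel) (1 / q')"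
  define K where "K = (2 powr p * p / (p - 1)) powr (1 / q) * (2 powr q' * q' / (q' - 1)) powr (1 / q')"
  define C where "C = 1 / (1 - 2 powr - \<alpha>)"
  define u where "u x = w x powr q" for x
  define \<sigma> where "\<sigma> x = w x powr - p'" for x
  define f where "f x = F x * ennreal (w x powr p')" for x
  have b: "0 < b" "b < 1" using \<alpha> by (auto simp: b_def n_def)
  have p': "1 < p'" "1 / p + 1 / p' = 1" using p by (auto simp: p'_def conj_exponent_def field_simps)
  have q': "1 < q'" "1 / q + 1 / q' = 1" "q' = q / (q - 1)"
    using p by (auto simp: q'_def conj_exponent_def field_simps)
  have qp: "q / p' = b" "1 / p - 1 / q = 1 - b" using pq by (simp_all add: b_def n_def p'_def)
  have C1: "0 < 1 - 2 powr - \<alpha>" using \<alpha> powr_less_mono[of "- \<alpha>" 0 2] by simp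
  \<comment> \<open>The two relations between the exponents give \<open>b * q = 1 + b\<close>; this is what makes the powers of \<open>w\<close>
    in \<open>dual\<close> cancel.\<close>
  have q1: "p' / q = q - 1"
  proof -
    have "1 / p' = b - 1 / q" using p'(2) qp(2) by linarith
    then have "q / p' = b * q - 1" using p by (simp add: field_simps)
    then have "b * q = 1 + b" using qp by simp
    then have "b * (q - 1) = 1" by (simp add: algebra_simps)
    moreover have "p' / q = 1 / b" using qp(1) by auto
    ultimately show ?thesis using b p'(1) by (simp add: field_simps)
  qed
  have [measurable]: "f \<in> borel_measurable borel" "u \<in> borel_measurable borel" "\<sigma> \<in> borel_measurable borel"
    unfolding f_def u_def \<sigma>_def by measurable
  have upos: "0 < u x" "0 < \<sigma> x" for x using w(2)[of x] by (auto simp: u_def \<sigma>_def)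
  have f\<sigma>: "f x * ennreal (\<sigma> x) = F x" for x
  proof -
    have "ennreal (w x powr p') * ennreal (\<sigma> x) = 1"
      using w(2)[of x] by (simp add: \<sigma>_def flip: ennreal_mult powr_add)
    then show ?thesis by (simp add: f_def mult.assoc)
  qed
  have fp: "ennpowr (f x) p * ennreal (\<sigma> x) = ennpowr (w x * F x) p" for x
  proof -
    have "p' * p + - p' = p" using p'(2) p p'(1) by (simp add: field_simps)
    then have eq: "ennreal ((w x powr p') powr p) * ennreal (\<sigma> x) = ennreal (w x powr p)"
      using w(2)[of x] by (simp add: \<sigma>_def powr_powr flip: ennreal_mult powr_add)
    have "ennpowr (f x) p * ennreal (\<sigma> x) = ennpowr (F x) p * (ennreal ((w x powr p') powr p) * ennreal (\<sigma> x))"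
      using p by (simp add: f_def ennpowr_mult ennpowr_ennreal mult.assoc)
    also have "\<dots> = ennpowr (w x * F x) p"
      unfolding eq using p w(2)[of x] by (simp add: ennpowr_mult ennpowr_ennreal mult.commute)
    finally show ?thesis .
  qed
  have dual: "\<sigma> x powr (1 / q) * u x powr (1 / q') = 1" for x
  proof -
    have "- p' * (1 / q) + q * (1 / q') = 0" using q1 q'(3) p by simp
    then show ?thesis using w(2)[of x] by (simp add: \<sigma>_def u_def powr_powr flip: powr_add)
  qed
  have trunc: "(\<integral>\<^sup>+x. (\<integral>\<^sup>+y. ennreal (riesz_kernel \<alpha> (x - y)) * F y * indicator {y. norm (x - y) < L / 3} y \<partial>lborel)
      * (g x * ennreal (u x)) \<partial>lborel) \<le> ?rhs" if L: "0 < L" for L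
  proof -
    define V where "V m = (L / 2 ^ m) ^ CARD('n)" for m :: nat
    have Vpos: "0 < V m" for m using L by (simp add: V_def)
    have C: "(\<Sum>m. if j \<le> m then ennreal (V m powr (1 - b)) else 0) \<le> ennreal C * ennreal (V j powr (1 - b))" for j
    proof -
      have Vb: "V m powr (1 - b) = L powr \<alpha> * (2 powr - \<alpha>) ^ m" for m
      proof -
        have "V m powr (1 - b) = (L / 2 ^ m) powr \<alpha>"
          using L by (simp add: V_def b_def n_def powr_powr flip: powr_realpow)
        also have "\<dots> = L powr \<alpha> * (2 ^ m) powr - \<alpha>"
          using L by (simp add: powr_divide powr_minus_divide)
        also have "(2 ^ m) powr - \<alpha> = (2 powr - \<alpha>) ^ m"
          by (simp add: powr_powr mult.commute flip: powr_realpow)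
        finally show ?thesis .
      qed
      show ?thesis
        unfolding Vb C_def using geometric_tail[of "2 powr - \<alpha>" "L powr \<alpha>" j] C1 by simp
    qed
    have one: "(\<integral>\<^sup>+x. (\<Sum>m. ennreal (V m powr (1 - b)) * nested_partition.cavg (grid_code S L) lborel m F x)
        * (g x * ennreal (u x)) \<partial>lborel) \<le> 4 * ennreal C * W * ennreal K * Nf * Ng" for S :: "'n set"
    proof -
      interpret nested_partition "grid_code S L" by (rule nested_partition_grid[OF L])
      have cell_pos: "0 < emeasure lborel (cell m x)" and cell_top: "emeasure lborel (cell m x) < top" for m x
        using L by (simp_all add: emeasure_grid_cell)
      have bal: "cavg lborel m (\<lambda>x. ennreal (u x)) x * ennpowr (cavg lborel m (\<lambda>x. ennreal (\<sigma> x)) x) b \<le> W" for m x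
        using cavg_le_Apq_const[OF L w, of q p S m x] p p'(1) qp(1)
        by (simp add: u_def[abs_def] \<sigma>_def[abs_def] W_def p'_def)
      have cpos: "0 < cavg lborel m (\<lambda>x. ennreal (h x)) x"
        if [measurable]: "h \<in> borel_measurable borel" and "\<And>x. 0 < h x" for h m x
      proof -
        have "0 < (\<integral>\<^sup>+y\<in>cell m x. ennreal (h y) \<partial>lborel)"
          using cell_pos[of m x] that(2) by (intro nn_integral_set_pos) simp_all
        then show ?thesis
          using cell_top[of m x] by (auto simp: cavg_def zero_less_iff_neq_zero)
      qed
      have prod: "cavg lborel m (\<lambda>x. ennreal (u x)) x * ennpowr (cavg lborel m (\<lambda>x. ennreal (\<sigma> x)) x) b < top" for m x
        using bal[of m x] A unfolding W_def by (rule order.strict_trans1)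
      \<comment> \<open>Both averages are positive, so finiteness of the product forces finiteness of each factor.\<close>
      have ctop: "cavg lborel m (\<lambda>x. ennreal (u x)) x < top" "cavg lborel m (\<lambda>x. ennreal (\<sigma> x)) x < top" for m x
        using prod[of m x] cpos[of u m x] cpos[of \<sigma> m x] upos b
        by (auto simp: ennreal_mult_less_top ennpowr_eq_0_iff ennpowr_less_top_iff)
      have dens: "cell_finite (density lborel (\<lambda>x. ennreal (h x)))"
        if [measurable]: "h \<in> borel_measurable borel" and "\<And>m x. cavg lborel m (\<lambda>x. ennreal (h x)) x < top" for h
      proof -
        have "emeasure (density lborel (\<lambda>x. ennreal (h x))) (cell m x) < top" for m x
        proof -
          have "emeasure (density lborel (\<lambda>x. ennreal (h x))) (cell m x) = (\<integral>\<^sup>+y\<in>cell m x. ennreal (h y) \<partial>lborel)"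
            by (rule emeasure_density) simp_all
          also have "\<dots> = cavg lborel m (\<lambda>x. ennreal (h x)) x * emeasure lborel (cell m x)"
            by (rule cavg_mult_measure[OF cell_finite_grid[OF L], symmetric]) simp
          also have "\<dots> < top" using that(2)[of m x] cell_top[of m x] by (simp add: ennreal_mult_less_top)
          finally show ?thesis .
        qed
        then show ?thesis by (simp add: cell_finite_def)
      qed
      have "(\<integral>\<^sup>+x. (\<Sum>m. ennreal (V m powr (1 - b)) * cavg lborel m (\<lambda>y. f y * \<sigma> y) x) * (g x * u x) \<partial>lborel)
        \<le> 4 * ennreal C * W * ennreal K
           * ennpowr (\<integral>\<^sup>+x. ennpowr (f x) p * \<sigma> x \<partial>lborel) (1 / p) * ennpowr (\<integral>\<^sup>+x. ennpowr (g x) q' * u x \<partial>lborel) (1 / q')"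
        unfolding K_def
        by (intro bilinear_estimate cell_finite_grid[OF L] Vpos b p qp(2) q'(1,2) C upos dual dens ctop bal)
           (use p fin in \<open>auto simp: V_def emeasure_grid_cell[OF L] fp\<close>)
      then show ?thesis by (simp add: f\<sigma> fp Nf_def Ng_def u_def)
    qed
    have [measurable]: "nested_partition.cavg (grid_code S L) lborel m F \<in> borel_measurable borel" for S :: "'n set" and m
      by (rule nested_partition.cavg_measurable[OF nested_partition_grid[OF L]])
    have "(\<integral>\<^sup>+x. (\<integral>\<^sup>+y. ennreal (riesz_kernel \<alpha> (x - y)) * F y * indicator {y. norm (x - y) < L / 3} y \<partial>lborel)
      * (g x * ennreal (u x)) \<partial>lborel)
      \<le> (\<integral>\<^sup>+x. ennreal (6 powr (n - \<alpha>)) * (\<Sum>S\<in>UNIV. \<Sum>m. ennreal (V m powr (1 - b))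
          * nested_partition.cavg (grid_code S L) lborel m F x) * (g x * ennreal (u x)) \<partial>lborel)"
      using truncated_riesz_le_grid_sum[OF \<alpha> L F]
      by (intro nn_integral_mono mult_right_mono) (simp_all add: n_def b_def V_def)
    also have "\<dots> = (\<integral>\<^sup>+x. ennreal (6 powr (n - \<alpha>)) * (\<Sum>S\<in>UNIV. (\<Sum>m. ennreal (V m powr (1 - b))
          * nested_partition.cavg (grid_code S L) lborel m F x) * (g x * ennreal (u x))) \<partial>lborel)"
      by (intro nn_integral_cong) (simp only: sum_distrib_right mult.assoc)
    also have "\<dots> = ennreal (6 powr (n - \<alpha>)) * (\<Sum>S\<in>UNIV. \<integral>\<^sup>+x. (\<Sum>m. ennreal (V m powr (1 - b))
          * nested_partition.cavg (grid_code S L) lborel m F x) * (g x * ennreal (u x)) \<partial>lborel)"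
      by (subst nn_integral_cmult, measurable, subst nn_integral_sum, measurable)
    also have "\<dots> \<le> ennreal (6 powr (n - \<alpha>)) * (\<Sum>S\<in>(UNIV :: 'n set set). 4 * ennreal C * W * ennreal K * Nf * Ng)"
      by (intro mult_left_mono sum_mono one) auto
    also have "\<dots> = (ennreal (6 powr (n - \<alpha>)) * ennreal (2 powr n) * (4 * ennreal C * ennreal K)) * W * Nf * Ng"
    proof -
      have "card (UNIV :: 'n set set) = 2 ^ CARD('n)" using card_Pow[of "UNIV :: 'n set"] by simp
      then have "of_nat (card (UNIV :: 'n set set)) = ennreal (2 powr n)"
        by (simp add: n_def powr_realpow ennreal_power flip: ennreal_numeral)
      then show ?thesis by (simp add: mult_ac)
    qed
    also have "ennreal (6 powr (n - \<alpha>)) * ennreal (2 powr n) * (4 * ennreal C * ennreal K)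
      = ennreal (riesz_const n \<alpha> p q q')"
      using C1 by (simp add: riesz_const_def C_def K_def flip: ennreal_mult ennreal_numeral)
    finally show ?thesis by (simp add: n_def q'_def W_def Nf_def Ng_def u_def)
  qed
  define T where "T k x = (\<integral>\<^sup>+y. ennreal (riesz_kernel \<alpha> (x - y)) * F y * indicator {y. norm (x - y) < real (Suc k) / 3} y \<partial>lborel)" for k x
  have [measurable]: "T k \<in> borel_measurable borel" for k unfolding T_def by measurable
  have incT: "incseq T"
    unfolding T_def by (intro monoI le_funI nn_integral_mono mult_left_mono) (auto split: split_indicator)
  have supT: "(\<integral>\<^sup>+y. ennreal (riesz_kernel \<alpha> (x - y)) * F y \<partial>lborel) = (SUP k. T k x)" for x
  proof -
    have "(SUP k. T k x) = (\<integral>\<^sup>+y. (SUP k. ennreal (riesz_kernel \<alpha> (x - y)) * F y * indicator {y. norm (x - y) < real (Suc k) / 3} y) \<partial>lborel)"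
      unfolding T_def
      by (rule nn_integral_monotone_convergence_SUP[symmetric])
         (auto intro!: monoI le_funI mult_left_mono split: split_indicator)
    also have "\<dots> = (\<integral>\<^sup>+y. ennreal (riesz_kernel \<alpha> (x - y)) * F y \<partial>lborel)"
    proof (intro nn_integral_cong antisym)
      fix y
      obtain k where "3 * norm (x - y) < real k" using reals_Archimedean2 by blast
      then show "ennreal (riesz_kernel \<alpha> (x - y)) * F y
          \<le> (SUP k. ennreal (riesz_kernel \<alpha> (x - y)) * F y * indicator {y. norm (x - y) < real (Suc k) / 3} y)"
        by (intro SUP_upper2[of k]) auto
    qed (auto intro!: SUP_least split: split_indicator)
    finally show ?thesis by simp
  qed
  have "(\<integral>\<^sup>+x. (\<integral>\<^sup>+y. ennreal (riesz_kernel \<alpha> (x - y)) * F y \<partial>lborel) * (g x * ennreal (w x powr q)) \<partial>lborel)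
      = (\<integral>\<^sup>+x. (SUP k. T k x * (g x * ennreal (u x))) \<partial>lborel)"
    unfolding supT by (simp add: u_def SUP_mult_right_ennreal)
  also have "\<dots> = (SUP k. \<integral>\<^sup>+x. T k x * (g x * ennreal (u x)) \<partial>lborel)"
    using incT by (intro nn_integral_monotone_convergence_SUP)
      (auto intro!: monoI le_funI mult_right_mono simp: incseq_def le_fun_def)
  also have "\<dots> \<le> ?rhs"
    unfolding T_def by (intro SUP_least trunc) simp
  finally show ?thesis .
qed

text \<open>Duality in \<open>L\<^sup>q\<close> of the measure with density \<open>w powr q\<close>.\<close>

theorem riesz_strong_type_nonneg:
  fixes w :: "real ^ 'n \<Rightarrow> real" and F :: "real ^ 'n \<Rightarrow> ennreal"
  assumes \<alpha>: "0 < \<alpha>" "\<alpha> < real CARD('n)" and p: "1 < p" "p < q"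
    and pq: "1 / p - 1 / q = \<alpha> / real CARD('n)" "q / conj_exponent p = 1 - \<alpha> / real CARD('n)"
    and w [measurable]: "w \<in> borel_measurable borel" "\<And>x. 0 < w x" and A: "Apq_const p q w < top"
    and F [measurable]: "F \<in> borel_measurable borel"
    and fin: "(\<integral>\<^sup>+x. ennpowr (w x * F x) p \<partial>lborel) < top"
  defines "B \<equiv> ennreal (riesz_const (real CARD('n)) \<alpha> p q (conj_exponent q)) * Apq_const p q w
        * ennpowr (\<integral>\<^sup>+x. ennpowr (w x * F x) p \<partial>lborel) (1 / p)"
  shows "B < top"
    and "(\<integral>\<^sup>+x. ennpowr (w x * (\<integral>\<^sup>+y. ennreal (riesz_kernel \<alpha> (x - y)) * F y \<partial>lborel)) q \<partial>lborel) \<le> ennpowr B q"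
proof -
  define H where "H x = (\<integral>\<^sup>+y. ennreal (riesz_kernel \<alpha> (x - y)) * F y \<partial>lborel)" for x
  define U where "U = density lborel (\<lambda>x. ennreal (w x powr q))"
  have [measurable]: "H \<in> borel_measurable borel" unfolding H_def by measurable
  have q': "1 < q" "1 < conj_exponent q" "1 / q + 1 / conj_exponent q = 1"
    using p by (auto simp: conj_exponent_def field_simps)
  show Btop: "B < top"
    unfolding B_def using A fin p by (simp add: ennreal_mult_less_top ennpowr_less_top_iff)
  have dens: "(\<integral>\<^sup>+x. h x \<partial>U) = (\<integral>\<^sup>+x. h x * ennreal (w x powr q) \<partial>lborel)"
    if [measurable]: "h \<in> borel_measurable borel" for h
    unfolding U_def by (simp add: nn_integral_density mult.commute)
  have "(\<integral>\<^sup>+x. ennpowr (H x) q \<partial>U) \<le> ennpowr B q"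
  proof (rule nn_integral_power_le_by_duality[OF q'])
    show "sigma_finite_measure U"
      unfolding U_def by (subst sigma_finite_measure.sigma_finite_iff_density_finite[OF sigma_finite_lborel]) auto
    show "H \<in> borel_measurable U" unfolding U_def by simp
    show "B < \<infinity>" using Btop by simp
    fix g :: "real ^ 'n \<Rightarrow> ennreal" assume "g \<in> borel_measurable U"
    then have [measurable]: "g \<in> borel_measurable borel" by (simp add: U_def)
    show "(\<integral>\<^sup>+x. H x * g x \<partial>U) \<le> B * ennpowr (\<integral>\<^sup>+x. ennpowr (g x) (conj_exponent q) \<partial>U) (1 / conj_exponent q)"
      using riesz_bilinear_bound[OF \<alpha> p pq w A F _ fin, of g]
      by (simp add: dens B_def H_def mult.assoc)
  qed
  also have "(\<integral>\<^sup>+x. ennpowr (H x) q \<partial>U) = (\<integral>\<^sup>+x. ennpowr (w x * H x) q \<partial>lborel)"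
    using q' w(2) by (subst dens) (auto simp: ennpowr_mult ennpowr_ennreal_pos mult.commute)
  finally show "(\<integral>\<^sup>+x. ennpowr (w x * (\<integral>\<^sup>+y. ennreal (riesz_kernel \<alpha> (x - y)) * F y \<partial>lborel)) q \<partial>lborel) \<le> ennpowr B q"
    by (simp add: H_def)
qed

section \<open>Weights and measurable representatives\<close>

lemma lebesgue_measurable_weight:
  fixes w :: "real ^ 'n \<Rightarrow> real"
  assumes "weight w" shows "w \<in> borel_measurable lebesgue"
proof (rule borel_measurable_LIMSEQ_real)
  fix k :: nat
  have "set_integrable lebesgue (cball 0 (real k)) w" using assms by (simp add: weight_def)
  then show "(\<lambda>x. indicator (cball 0 (real k)) x *\<^sub>R w x) \<in> borel_measurable lebesgue"
    unfolding set_integrable_def by (rule borel_measurable_integrable)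
next
  fix x :: "real ^ 'n"
  obtain N :: nat where "norm x \<le> real N" using real_arch_simple by blast
  then have "\<forall>\<^sub>F k in sequentially. indicator (cball 0 (real k)) x *\<^sub>R w x = w x"
    by (intro eventually_sequentiallyI[of N]) auto
  then show "(\<lambda>k. indicator (cball 0 (real k)) x *\<^sub>R w x) \<longlonglongrightarrow> w x"
    by (rule tendsto_eventually)
qed

text \<open>The half-side is \<open>Suc k\<close>, so that the first of these cubes is not degenerate.\<close>

definition centered_cube :: "nat \<Rightarrow> (real ^ 'n) set" where
  "centered_cube k = cbox (\<chi> i. - real (Suc k)) ((\<chi> i. - real (Suc k)) + (\<chi> i. 2 * real (Suc k)))"

lemma centered_cube_in_cubes: "centered_cube k \<in> cubes"
  unfolding centered_cube_def cubes_def by (intro CollectI exI conjI, rule refl) simp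

lemma eventually_in_centered_cube:
  fixes x :: "real ^ 'n"
  obtains k0 where "\<And>k. k0 \<le> k \<Longrightarrow> x \<in> centered_cube k"
proof -
  obtain N :: nat where N: "norm x \<le> real N" using real_arch_simple by blast
  have "x \<in> centered_cube k" if "N \<le> k" for k
  proof -
    have "\<bar>x $ i\<bar> \<le> real (Suc k)" for i
      using component_le_norm_cart[of x i] N that by simp
    then have "- real (Suc k) \<le> x $ i \<and> x $ i \<le> real (Suc k)" for i
      unfolding abs_le_iff by (metis minus_le_iff)
    then show ?thesis by (auto simp: centered_cube_def mem_box_cart)
  qed
  then show ?thesis using that by blast
qed

text \<open>If \<open>w\<close> vanishes on a set of positive measure, then the average of \<open>w powr - p'\<close> is infinite on all
  large cubes. Because of the convention \<open>0 * \<infinity> = 0\<close> this does not contradict the finiteness of the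
  constant, but it forces the average of \<open>w powr q\<close> to be \<open>0\<close> on these cubes.\<close>

lemma Apq_zero_or_pos:
  fixes w :: "real ^ 'n \<Rightarrow> real"
  assumes w: "w \<in> borel_measurable lebesgue" "\<And>x. 0 \<le> w x" and A: "Apq_const p q w < top"
    and p: "0 < q" "0 < conj_exponent p"
  shows "(AE x in lebesgue. w x = 0) \<or> (AE x in lebesgue. 0 < w x)"
proof (rule disjCI)
  note [measurable] = w(1)
  assume notpos: "\<not> (AE x in lebesgue. 0 < w x)"
  define Z where "Z = {x. w x = 0}"
  have [measurable]: "Z \<in> sets lebesgue" 
    using measurable_sets[OF w(1), of "{0}"] by (simp add: Z_def vimage_def)
  have [measurable]: "centered_cube k \<in> sets lebesgue" for k by (simp add: centered_cube_def)
  have "\<exists>k0. Z \<inter> centered_cube k0 \<notin> null_sets lebesgue"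
  proof (rule ccontr)
    assume "\<not> ?thesis"
    then have "(\<Union>k. Z \<inter> centered_cube k) \<in> null_sets lebesgue"
      by (intro null_sets_UN) blast
    moreover have "Z = (\<Union>k. Z \<inter> centered_cube k)"
    proof (intro set_eqI iffI)
      fix x assume "x \<in> Z"
      moreover obtain k where "x \<in> centered_cube k" using eventually_in_centered_cube[of x] by blast
      ultimately show "x \<in> (\<Union>k. Z \<inter> centered_cube k)" by blast
    qed blast
    ultimately have "Z \<in> null_sets lebesgue" by simp
    then have "AE x in lebesgue. x \<notin> Z" by (rule AE_not_in)
    then have "AE x in lebesgue. 0 < w x"
      by eventually_elim (use w(2) in \<open>auto simp: Z_def less_le\<close>)
    with notpos show False ..
  qed
  then obtain k0 where k0: "Z \<inter> centered_cube k0 \<notin> null_sets lebesgue" by blast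
  have vanish: "AE x in lebesgue. x \<in> centered_cube k \<longrightarrow> w x = 0" if k: "k0 \<le> k" for k
  proof -
    define Q where "Q = (centered_cube k :: (real ^ 'n) set)"
    have Qm [measurable]: "Q \<in> sets lebesgue" by (simp add: Q_def)
    have vol: "emeasure lebesgue Q \<noteq> 0" "emeasure lebesgue Q \<noteq> top"
      using emeasure_cube(1)[of "2 * real (Suc k)" "(\<chi> i. - real (Suc k)) :: real ^ 'n"]
      by (auto simp: Q_def centered_cube_def)
    have sub: "(centered_cube k0 :: (real ^ 'n) set) \<subseteq> Q"
      using k by (auto simp: Q_def centered_cube_def mem_box_cart) (smt (verit) of_nat_mono)+
    have "Z \<inter> Q \<notin> null_sets lebesgue"
    proof
      assume "Z \<inter> Q \<in> null_sets lebesgue"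
      then have "Z \<inter> centered_cube k0 \<in> null_sets lebesgue"
      proof (rule null_sets_subset)
        show "Z \<inter> centered_cube k0 \<subseteq> Z \<inter> Q" using sub by blast
      qed simp
      with k0 show False ..
    qed
    then have "emeasure lebesgue (Z \<inter> Q) \<noteq> 0" by (simp add: null_sets_def)
    then have "top = \<infinity> * emeasure lebesgue (Z \<inter> Q)" by (simp add: ennreal_top_mult)
    also have "\<dots> = (\<integral>\<^sup>+x. \<infinity> * indicator (Z \<inter> Q) x \<partial>lebesgue)"
      by (rule nn_integral_cmult_indicator[symmetric]) simp
    also have "\<dots> \<le> (\<integral>\<^sup>+x\<in>Q. ennpowr (ennreal (w x)) (- conj_exponent p) \<partial>lebesgue)"
      by (intro nn_integral_mono) (use p in \<open>auto simp: Z_def ennpowr_def split: split_indicator\<close>)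
    finally have "avg Q (\<lambda>x. ennpowr (ennreal (w x)) (- conj_exponent p)) = top"
      using vol by (simp add: avg_def top_unique ennreal_top_divide)
    moreover have "avg Q (\<lambda>x. ennpowr (ennreal (w x)) q) * ennpowr (avg Q (\<lambda>x. ennpowr (ennreal (w x)) (- conj_exponent p))) (q / conj_exponent p)
        \<le> Apq_const p q w"
      unfolding Apq_const_def by (rule SUP_upper) (simp add: Q_def centered_cube_in_cubes)
    ultimately have "avg Q (\<lambda>x. ennpowr (ennreal (w x)) q) = 0"
      using A p by (auto simp: ennreal_mult_top split: if_splits)
    then have "(\<integral>\<^sup>+x\<in>Q. ennpowr (ennreal (w x)) q \<partial>lebesgue) = 0"
      using vol by (simp add: avg_def)
    then have "AE x in lebesgue. ennpowr (ennreal (w x)) q * indicator Q x = 0"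
      by (subst (asm) nn_integral_0_iff_AE) auto
    then show ?thesis
      by eventually_elim
         (use w(2) p in \<open>auto simp: Q_def ennpowr_eq_0_iff ennreal_eq_0_iff antisym split: split_indicator_asm\<close>)
  qed
  have "AE x in lebesgue. \<forall>k. k0 \<le> k \<longrightarrow> x \<in> centered_cube k \<longrightarrow> w x = 0"
    unfolding AE_all_countable using vanish by (auto intro: AE_I2)
  then show "AE x in lebesgue. w x = 0"
  proof eventually_elim
    case (elim x)
    obtain k1 where "\<And>k. k1 \<le> k \<Longrightarrow> x \<in> centered_cube k" using eventually_in_centered_cube by blast
    then show ?case using elim by (meson max.cobounded1 max.cobounded2)
  qed
qed

lemma Apq_const_cong_AE:
  assumes "AE x in lebesgue. w x = v x" shows "Apq_const p q w = Apq_const p q v"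
proof -
  have "avg Q (\<lambda>x. ennpowr (ennreal (w x)) r) = avg Q (\<lambda>x. ennpowr (ennreal (v x)) r)" for Q r
    unfolding avg_def using assms by (intro arg_cong2[where f = "(/)"] nn_integral_cong_AE refl) auto
  then show ?thesis by (simp add: Apq_const_def)
qed

text \<open>Iterated integrals call for functions that are measurable on the product, which a Lebesgue measurable
  integrand need not be; a Borel representative is.\<close>

lemma lebesgue_complex_Borel_representative:
  fixes f :: "'a::euclidean_space \<Rightarrow> complex"
  assumes "f \<in> borel_measurable lebesgue"
  obtains g where "g \<in> borel_measurable borel" "AE x in lebesgue. f x = g x"
proof -
  have re: "(\<lambda>x. Re (f x)) \<in> borel_measurable lebesgue" and im: "(\<lambda>x. Im (f x)) \<in> borel_measurable lebesgue"
    using assms by (simp_all add: borel_measurable_complex_iff)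
  obtain a where a: "a \<in> borel_measurable lborel" "AE x in lborel. Re (f x) = a x"
    using completion_ex_borel_measurable_real[OF re] by blast
  obtain b where b: "b \<in> borel_measurable lborel" "AE x in lborel. Im (f x) = b x"
    using completion_ex_borel_measurable_real[OF im] by blast
  note ab = a b
  have "(\<lambda>x. Complex (a x) (b x)) \<in> borel_measurable borel"
    using ab by (simp add: borel_measurable_complex_iff)
  moreover have "AE x in lebesgue. f x = Complex (a x) (b x)"
  proof (rule AE_completion)
    show "AE x in lborel. f x = Complex (a x) (b x)"
      using a(2) b(2) by eventually_elim (simp add: complex_eq_iff)
  qed
  ultimately show ?thesis using that by blast
qed

section \<open>The weighted inequality at the critical exponent\<close>

text \<open>A weight that vanishes almost everywhere makes all assertions trivial. Any other weight is positive
  almost everywhere, and then \<open>w\<close> and \<open>f\<close> may be replaced by Borel functions, the first positive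
  everywhere. The bound for the potential of the absolute value of \<open>f\<close> shows first that this potential
  is finite almost everywhere, hence that the integral defining the potential of \<open>f\<close> converges, and then
  yields the norm inequality.\<close>

theorem riesz_weighted_bound:
  fixes w :: "real ^ 'n \<Rightarrow> real" and f :: "real ^ 'n \<Rightarrow> complex"
  assumes \<alpha>: "0 < \<alpha>" "\<alpha> < real CARD('n)" and p: "1 < p" "p < q"
    and pq: "1 / p - 1 / q = \<alpha> / real CARD('n)" "q / conj_exponent p = 1 - \<alpha> / real CARD('n)"
    and w: "w \<in> Apq p q" and f: "(\<lambda>x. w x *\<^sub>R f x) \<in> Lp_space lebesgue p"
  shows "(AE x in lebesgue. w x \<noteq> 0 \<longrightarrow> riesz_converges \<alpha> f x) \<and>
    (\<lambda>x. w x *\<^sub>R riesz_potential \<alpha> f x) \<in> Lp_space lebesgue q \<and>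
    Lp_norm lebesgue q (\<lambda>x. w x *\<^sub>R riesz_potential \<alpha> f x)
      \<le> ennreal (riesz_const (real CARD('n)) \<alpha> p q (conj_exponent q)) * Apq_const p q w * Lp_norm lebesgue p (\<lambda>x. w x *\<^sub>R f x)"
proof -
  have A: "Apq_const p q w < top" and weight: "weight w" using w by (auto simp: Apq_def)
  have wm [measurable]: "w \<in> borel_measurable lebesgue" by (rule lebesgue_measurable_weight[OF weight])
  have w0: "0 \<le> w x" for x using weight by (simp add: weight_def)
  have p': "0 < q" "0 < conj_exponent p" using p by (auto simp: conj_exponent_def)
  consider (zero) "AE x in lebesgue. w x = 0" | (pos) "AE x in lebesgue. 0 < w x"
    using Apq_zero_or_pos[OF wm w0 A p'] by blast
  then show ?thesis
  proof cases
    case zero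
    have null: "AE x in lebesgue. w x *\<^sub>R riesz_potential \<alpha> f x = 0" using zero by eventually_elim simp
    have meas: "(\<lambda>x. w x *\<^sub>R riesz_potential \<alpha> f x) \<in> borel_measurable lebesgue"
    proof (rule borel_measurable_AE)
      show "AE x in lebesgue. 0 = w x *\<^sub>R riesz_potential \<alpha> f x" using null by eventually_elim simp
    qed simp
    have "(\<integral>\<^sup>+x. ennreal (norm (w x *\<^sub>R riesz_potential \<alpha> f x) powr q) \<partial>lebesgue) = (\<integral>\<^sup>+x. 0 \<partial>(lebesgue :: (real ^ 'n) measure))"
      by (rule nn_integral_cong_AE) (use null in eventually_elim, simp)
    then have "Lp_norm lebesgue q (\<lambda>x. w x *\<^sub>R riesz_potential \<alpha> f x) = 0"
      using p' by (simp add: Lp_norm_def)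
    moreover have "AE x in lebesgue. w x \<noteq> 0 \<longrightarrow> riesz_converges \<alpha> f x" using zero by eventually_elim simp
    ultimately show ?thesis using meas by (simp add: Lp_space_def)
  next
    case pos
    obtain w1 where w1: "w1 \<in> borel_measurable lborel" "AE x in lborel. w x = w1 x"
      using completion_ex_borel_measurable_real[OF wm] by blast
    \<comment> \<open>The value \<open>1\<close> on the exceptional null set is arbitrary; only its positivity matters.\<close>
    define v where "v x = (if 0 < w1 x then w1 x else 1)" for x
    have v [measurable]: "v \<in> borel_measurable borel" unfolding v_def using w1(1) by simp
    have vpos: "0 < v x" for x by (simp add: v_def)
    have wv: "AE x in lebesgue. w x = v x"
      using pos AE_completion[OF w1(2)] by eventually_elim (simp add: v_def)
    have wf: "(\<lambda>x. w x *\<^sub>R f x) \<in> borel_measurable lebesgue" "Lp_norm lebesgue p (\<lambda>x. w x *\<^sub>R f x) < top"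
      using f by (auto simp: Lp_space_def)
    obtain h where h [measurable]: "h \<in> borel_measurable borel" and wfh: "AE x in lebesgue. w x *\<^sub>R f x = h x"
      using lebesgue_complex_Borel_representative[OF wf(1)] by blast
    define k where "k x = (1 / v x) *\<^sub>R h x" for x
    have k [measurable]: "k \<in> borel_measurable borel" unfolding k_def by measurable
    have fk: "AE x in lebesgue. k x = f x"
      using wv wfh
    proof eventually_elim
      case (elim x)
      then have "h x = v x *\<^sub>R f x" by simp
      then show ?case using vpos[of x] by (simp add: k_def)
    qed
    have fm [measurable]: "f \<in> borel_measurable lebesgue"
      by (rule borel_measurable_AE[OF _ fk]) (simp add: measurable_completion)
    define F where "F x = ennreal (norm (k x))" for x
    define H where "H x = (\<integral>\<^sup>+y. ennreal (riesz_kernel \<alpha> (x - y)) * F y \<partial>lborel)" for x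
    have F [measurable]: "F \<in> borel_measurable borel" unfolding F_def by measurable
    have [measurable]: "H \<in> borel_measurable borel" unfolding H_def by measurable
    have ker: "(\<lambda>y. riesz_kernel \<alpha> (x - y)) \<in> borel_measurable lebesgue" for x
      by (rule measurable_completion) measurable
    have Nf: "Lp_norm lebesgue p (\<lambda>x. w x *\<^sub>R f x) = ennpowr (\<integral>\<^sup>+x. ennpowr (v x * F x) p \<partial>lborel) (1 / p)"
    proof -
      have "(\<integral>\<^sup>+x. ennreal (norm (w x *\<^sub>R f x) powr p) \<partial>lebesgue) = (\<integral>\<^sup>+x. ennpowr (v x * F x) p \<partial>lebesgue)"
      proof (rule nn_integral_cong_AE)
        show "AE x in lebesgue. ennreal (norm (w x *\<^sub>R f x) powr p) = ennpowr (v x * F x) p"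
          using wv fk
        proof eventually_elim
          case (elim x)
          have "ennreal (v x) * F x = ennreal (norm (w x *\<^sub>R f x))"
            using elim vpos[of x] by (simp add: F_def flip: ennreal_mult)
          then show ?case using p by (simp add: ennpowr_ennreal)
        qed
      qed
      then show ?thesis by (simp add: Lp_norm_def nn_integral_completion)
    qed
    have A': "Apq_const p q v < top" using A Apq_const_cong_AE[OF wv, of p q] by simp
    have fin: "(\<integral>\<^sup>+x. ennpowr (v x * F x) p \<partial>lborel) < top"
      using wf(2) p unfolding Nf by (simp add: ennpowr_less_top_iff)
    define B where "B = ennreal (riesz_const (real CARD('n)) \<alpha> p q (conj_exponent q)) * Apq_const p q w
        * Lp_norm lebesgue p (\<lambda>x. w x *\<^sub>R f x)"
    have B: "B < top" and main: "(\<integral>\<^sup>+x. ennpowr (v x * H x) q \<partial>lborel) \<le> ennpowr B q"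
      using riesz_strong_type_nonneg[OF \<alpha> p pq v vpos A' F fin]
      unfolding B_def Nf Apq_const_cong_AE[OF wv] H_def by simp_all
    have "(\<integral>\<^sup>+x. ennpowr (v x * H x) q \<partial>lborel) \<noteq> \<infinity>"
      using main B p' by (metis ennpowr_less_top_iff infinity_ennreal_def leD)
    then have "AE x in lborel. ennpowr (v x * H x) q \<noteq> \<infinity>"
      by (intro nn_integral_PInf_AE) auto
    then have Hfin: "AE x in lborel. H x < top"
    proof eventually_elim
      case (elim x)
      then show ?case using p' vpos[of x]
        by (auto simp: ennpowr_eq_top_iff ennreal_mult_eq_top_iff less_top ennreal_eq_0_iff not_le)
    qed
    have normH: "(\<integral>\<^sup>+y. ennreal (norm (riesz_kernel \<alpha> (x - y) *\<^sub>R f y)) \<partial>lebesgue) = H x" for x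
    proof -
      have "(\<integral>\<^sup>+y. ennreal (norm (riesz_kernel \<alpha> (x - y) *\<^sub>R f y)) \<partial>lebesgue)
         = (\<integral>\<^sup>+y. ennreal (riesz_kernel \<alpha> (x - y)) * F y \<partial>lebesgue)"
      proof (rule nn_integral_cong_AE)
        show "AE y in lebesgue. ennreal (norm (riesz_kernel \<alpha> (x - y) *\<^sub>R f y)) = ennreal (riesz_kernel \<alpha> (x - y)) * F y"
          using fk by eventually_elim (simp add: F_def riesz_kernel_nonneg flip: ennreal_mult)
      qed
      then show ?thesis by (simp add: nn_integral_completion H_def)
    qed
    have integrand: "(\<lambda>y. riesz_kernel \<alpha> (x - y) *\<^sub>R f y) \<in> borel_measurable lebesgue" for x
      using ker fm by (rule borel_measurable_scaleR)
    have conv: "riesz_converges \<alpha> f x" if "H x < top" for x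
      unfolding riesz_converges_def
      by (rule integrableI_bounded[OF integrand]) (simp only: normH infinity_ennreal_def that)
    have conv_AE: "AE x in lebesgue. w x \<noteq> 0 \<longrightarrow> riesz_converges \<alpha> f x"
      using AE_completion[OF Hfin] by eventually_elim (simp add: conv)
    have potential_le: "ennreal (norm (riesz_potential \<alpha> f x)) \<le> H x" for x
    proof (cases "riesz_converges \<alpha> f x")
      case True
      then show ?thesis
        unfolding riesz_converges_def riesz_potential_def normH[symmetric] by (rule integral_norm_bound_ennreal)
    next
      case False
      then show ?thesis
        unfolding riesz_converges_def riesz_potential_def by (simp add: not_integrable_integral_eq)
    qed
    have "riesz_potential \<alpha> f x = (LINT y|lborel. riesz_kernel \<alpha> (x - y) *\<^sub>R k y)" for x
    proof -
      have "(LINT y|lebesgue. riesz_kernel \<alpha> (x - y) *\<^sub>R f y) = (LINT y|lebesgue. riesz_kernel \<alpha> (x - y) *\<^sub>R k y)"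
      proof (rule integral_cong_AE[OF integrand])
        show "(\<lambda>y. riesz_kernel \<alpha> (x - y) *\<^sub>R k y) \<in> borel_measurable lebesgue"
          by (rule measurable_completion) measurable
        show "AE y in lebesgue. riesz_kernel \<alpha> (x - y) *\<^sub>R f y = riesz_kernel \<alpha> (x - y) *\<^sub>R k y"
          using fk by eventually_elim simp
      qed
      also have "\<dots> = (LINT y|lborel. riesz_kernel \<alpha> (x - y) *\<^sub>R k y)"
        by (rule integral_completion) measurable
      finally show ?thesis by (simp add: riesz_potential_def)
    qed
    moreover have "(\<lambda>x. LINT y|lborel. riesz_kernel \<alpha> (x - y) *\<^sub>R k y) \<in> borel_measurable borel"
      by measurable
    ultimately have "riesz_potential \<alpha> f \<in> borel_measurable borel" by (simp cong: measurable_cong)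
    then have "riesz_potential \<alpha> f \<in> borel_measurable lebesgue" by (simp add: measurable_completion)
    then have meas: "(\<lambda>x. w x *\<^sub>R riesz_potential \<alpha> f x) \<in> borel_measurable lebesgue"
      using wm by (intro borel_measurable_scaleR)
    have "(\<integral>\<^sup>+x. ennreal (norm (w x *\<^sub>R riesz_potential \<alpha> f x) powr q) \<partial>lebesgue)
        \<le> (\<integral>\<^sup>+x. ennpowr (v x * H x) q \<partial>lebesgue)"
    proof (rule nn_integral_mono_AE)
      show "AE x in lebesgue. ennreal (norm (w x *\<^sub>R riesz_potential \<alpha> f x) powr q) \<le> ennpowr (v x * H x) q"
        using wv
      proof eventually_elim
        case (elim x)
        have "ennreal (norm (w x *\<^sub>R riesz_potential \<alpha> f x) powr q) = ennpowr (ennreal (norm (w x *\<^sub>R riesz_potential \<alpha> f x))) q"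
          using p' by (simp add: ennpowr_ennreal)
        also have "ennreal (norm (w x *\<^sub>R riesz_potential \<alpha> f x)) = ennreal (v x) * ennreal (norm (riesz_potential \<alpha> f x))"
          using elim vpos[of x] by (simp flip: ennreal_mult)
        also have "ennpowr \<dots> q \<le> ennpowr (v x * H x) q"
          using p' potential_le by (intro ennpowr_mono mult_left_mono) auto
        finally show ?case .
      qed
    qed
    also have "\<dots> \<le> ennpowr B q" using main by (simp add: nn_integral_completion)
    finally have norm_le: "Lp_norm lebesgue q (\<lambda>x. w x *\<^sub>R riesz_potential \<alpha> f x) \<le> B"
      unfolding Lp_norm_def using p' by (subst ennpowr_le_iff_root) auto
    then show ?thesis
      using conv_AE meas B by (auto simp: Lp_space_def B_def order.strict_trans1)
  qed
qed

theorem theorem2p3: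
  fixes \<alpha> p0 q0 :: real
  assumes "0 < \<alpha>" and "\<alpha> < real CARD('n::finite)"
    and "1 < p0" and "p0 < real CARD('n) / \<alpha>"
    and "1 / q0 = 1 / p0 - \<alpha> / real CARD('n)"
    and "q0 / conj_exponent p0 = 1 - \<alpha> / real CARD('n)"
  shows "\<exists>c>0. \<forall>(w :: real ^ 'n \<Rightarrow> real) (f :: real ^ 'n \<Rightarrow> complex).
           w \<in> Apq p0 q0 \<longrightarrow> (\<lambda>x. w x *\<^sub>R f x) \<in> Lp_space lebesgue p0 \<longrightarrow>
             (AE x in lebesgue. w x \<noteq> 0 \<longrightarrow> riesz_converges \<alpha> f x) \<and>
             (\<lambda>x. w x *\<^sub>R riesz_potential \<alpha> f x) \<in> Lp_space lebesgue q0 \<and>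
             Lp_norm lebesgue q0 (\<lambda>x. w x *\<^sub>R riesz_potential \<alpha> f x)
               \<le> ennreal c * Apq_const p0 q0 w * Lp_norm lebesgue p0 (\<lambda>x. w x *\<^sub>R f x)"
proof -
  have n: "0 < real CARD('n)" by simp
  have "\<alpha> / real CARD('n) < 1 / p0" using assms(1,3,4) n by (simp add: field_simps)
  then have "0 < 1 / q0" using assms(5) by simp
  then have q0: "0 < q0" by simp
  have "1 / q0 < 1 / p0" using assms(1,5) n by simp
  then have pq: "p0 < q0" using q0 assms(3) by (simp add: field_simps)
  have gain: "1 / p0 - 1 / q0 = \<alpha> / real CARD('n)" using assms(5) by simp
  have "1 < conj_exponent q0" using pq assms(3) by (simp add: conj_exponent_def field_simps)
  moreover have "2 powr - \<alpha> < 1" using assms(1) powr_less_mono[of "- \<alpha>" 0 2] by simp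
  ultimately have pos: "0 < riesz_const (real CARD('n)) \<alpha> p0 q0 (conj_exponent q0)"
    using assms(3) by (simp add: riesz_const_def)
  show ?thesis
    by (rule exI, rule conjI, rule pos, intro allI impI, rule riesz_weighted_bound[OF assms(1-3) pq gain assms(6)])
qed

end
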